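(* Let $\beta_1\in\mathbb{R}$, $\beta_2>0$, and set $\theta_2=\tfrac14\beta_2$, $\theta_1=\tfrac12(\beta_1+\beta_2)$. Suppose $(\theta_1,\theta_2)\in\Theta_1$, i.e. either $\theta_1=0$ and $0<\theta_2<1/2$, or $\theta_1\neq0$ and $\theta_2>0$. Then there exists a unique $p_0\in(0,1)$ such that for every $\delta>0$ there are constants $C>0$ and $N$ (depending on $\delta,\theta_1,\theta_2$ but not on $n$) with $$\mathbb{P}_{n,\beta}\Big(\max_{1\le i\le n}\Big|\frac{d_i}{n-1}-p_0\Big|>\delta\Big)\le e^{-Cn}\qquad\text{for all } n\ge N.$$
   Context: $\mathcal{X}_n$ is the set of simple graphs on $\{1,\dots,n\}$, identified with their adjacency matrices $x=(x_{ij})$ (symmetric, zero diagonal, $0/1$ off-diagonal entries). The two star model is the probability mass function on $\mathcal{X}_n$ $$\mathbb{P}_{n,\beta}(x)=\frac{1}{Z_n(\beta)}\exp\Big\{\frac{\beta_2}{n-1}T(x)+\Big(\beta_1+\frac{\beta_2}{n-1}\Big)E(x)\Big\},$$ with $T(x)=\sum_i\sum_{j<l;\,j,l\ne i}x_{ij}x_{il}$ (number of two stars), $E(x)=\sum_{i<j}x_{ij}$ (number of edges), and $Z_n(\beta)$ the normalizing constant. $d_i=d_i(x)=\sum_{j\ne i}x_{ij}$ is the degree of vertex $i$ in the random graph $x\sim\mathbb{P}_{n,\beta}$. The parameters $\beta_1,\beta_2$ are fixed and do not depend on $n$. *)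

theory Defs
  imports "HOL-Probability.Probability"
begin

text \<open>
  A graph on \<open>{1..n}\<close> is its adjacency matrix, represented as a function that vanishes
  outside \<open>{1..n} \<times> {1..n}\<close>, so that distinct elements are distinct graphs.
\<close>

definition simple_graphs :: "nat \<Rightarrow> (nat \<Rightarrow> nat \<Rightarrow> nat) set" where
  "simple_graphs n =
    {x. (\<forall>i j. x i j \<in> {0, 1}) \<and> (\<forall>i j. x i j = x j i) \<and> (\<forall>i. x i i = 0) \<and>
        (\<forall>i j. i \<notin> {1..n} \<or> j \<notin> {1..n} \<longrightarrow> x i j = 0)}"

definition vertex_degree :: "nat \<Rightarrow> (nat \<Rightarrow> nat \<Rightarrow> nat) \<Rightarrow> nat \<Rightarrow> nat" where
  "vertex_degree n x i = (\<Sum>j\<in>{1..n} - {i}. x i j)"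

definition num_edges :: "nat \<Rightarrow> (nat \<Rightarrow> nat \<Rightarrow> nat) \<Rightarrow> nat" where
  "num_edges n x = (\<Sum>i\<in>{1..n}. \<Sum>j\<in>{i<..n}. x i j)"

definition num_two_stars :: "nat \<Rightarrow> (nat \<Rightarrow> nat \<Rightarrow> nat) \<Rightarrow> nat" where
  "num_two_stars n x =
    (\<Sum>i\<in>{1..n}. \<Sum>j\<in>{1..n} - {i}. \<Sum>l\<in>{j<..n} - {i}. x i j * x i l)"

definition two_star_weight :: "nat \<Rightarrow> real \<Rightarrow> real \<Rightarrow> (nat \<Rightarrow> nat \<Rightarrow> nat) \<Rightarrow> real" where
  "two_star_weight n \<beta>\<^sub>1 \<beta>\<^sub>2 x =
    exp (\<beta>\<^sub>2 / (real n - 1) * real (num_two_stars n x) +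
         (\<beta>\<^sub>1 + \<beta>\<^sub>2 / (real n - 1)) * real (num_edges n x))"

definition two_star_Z :: "nat \<Rightarrow> real \<Rightarrow> real \<Rightarrow> real" where
  "two_star_Z n \<beta>\<^sub>1 \<beta>\<^sub>2 = (\<Sum>x\<in>simple_graphs n. two_star_weight n \<beta>\<^sub>1 \<beta>\<^sub>2 x)"

definition two_star_pmf :: "nat \<Rightarrow> real \<Rightarrow> real \<Rightarrow> (nat \<Rightarrow> nat \<Rightarrow> nat) pmf" where
  "two_star_pmf n \<beta>\<^sub>1 \<beta>\<^sub>2 =
    embed_pmf (\<lambda>x. if x \<in> simple_graphs n
                   then two_star_weight n \<beta>\<^sub>1 \<beta>\<^sub>2 x / two_star_Z n \<beta>\<^sub>1 \<beta>\<^sub>2 else 0)"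

definition Theta1 :: "(real \<times> real) set" where
  "Theta1 = {(\<theta>\<^sub>1, \<theta>\<^sub>2). (\<theta>\<^sub>1 = 0 \<and> 0 < \<theta>\<^sub>2 \<and> \<theta>\<^sub>2 < 1/2) \<or> (\<theta>\<^sub>1 \<noteq> 0 \<and> \<theta>\<^sub>2 > 0)}"

lemma finite_simple_graphs: "finite (simple_graphs n)"
proof (rule finite_subset)
  let ?g = "\<lambda>A i j. if (i, j) \<in> A then 1 else (0 :: nat)"
  show "simple_graphs n \<subseteq> ?g ` Pow ({1..n} \<times> {1..n})"
  proof
    fix x assume x: "x \<in> simple_graphs n"
    have "x = ?g {(i, j). x i j = 1}"
    proof (intro ext)
      fix i j
      have "x i j \<in> {0, 1}" using x unfolding simple_graphs_def by blast
      then show "x i j = ?g {(i, j). x i j = 1} i j" by auto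
    qed
    moreover have "{(i, j). x i j = 1} \<subseteq> {1..n} \<times> {1..n}"
    proof -
      have "i \<in> {1..n} \<and> j \<in> {1..n}" if "x i j = 1" for i j
      proof (rule ccontr)
        assume "\<not> (i \<in> {1..n} \<and> j \<in> {1..n})"
        then have "x i j = 0" using x unfolding simple_graphs_def by blast
        with that show False by simp
      qed
      then show ?thesis by blast
    qed
    ultimately show "x \<in> ?g ` Pow ({1..n} \<times> {1..n})" by blast
  qed
qed simp

lemma two_star_Z_pos: "two_star_Z n \<beta>\<^sub>1 \<beta>\<^sub>2 > 0"
proof -
  have "(\<lambda>i j. 0) \<in> simple_graphs n" by (simp add: simple_graphs_def)
  then show ?thesis
    unfolding two_star_Z_def two_star_weight_def
    by (intro sum_pos) (auto simp: finite_simple_graphs)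
qed

lemma pmf_two_star_pmf:
  "pmf (two_star_pmf n \<beta>\<^sub>1 \<beta>\<^sub>2) x =
    (if x \<in> simple_graphs n then two_star_weight n \<beta>\<^sub>1 \<beta>\<^sub>2 x / two_star_Z n \<beta>\<^sub>1 \<beta>\<^sub>2 else 0)"
proof -
  let ?f = "\<lambda>x. if x \<in> simple_graphs n
                then two_star_weight n \<beta>\<^sub>1 \<beta>\<^sub>2 x / two_star_Z n \<beta>\<^sub>1 \<beta>\<^sub>2 else 0"
  have nonneg: "0 \<le> ?f y" for y
    using two_star_Z_pos[of n \<beta>\<^sub>1 \<beta>\<^sub>2] by (simp add: two_star_weight_def)
  have "(\<integral>\<^sup>+y. ennreal (?f y) \<partial>count_space UNIV) = (\<Sum>y\<in>simple_graphs n. ennreal (?f y))"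
    by (rule nn_integral_count_space'[OF finite_simple_graphs]) auto
  also have "\<dots> = ennreal (\<Sum>y\<in>simple_graphs n. ?f y)"
    by (rule sum_ennreal) (rule nonneg)
  also have "(\<Sum>y\<in>simple_graphs n. ?f y) = 1"
    using two_star_Z_pos[of n \<beta>\<^sub>1 \<beta>\<^sub>2]
    by (simp add: sum_divide_distrib[symmetric] two_star_Z_def[symmetric])
  finally have total: "(\<integral>\<^sup>+y. ennreal (?f y) \<partial>count_space UNIV) = 1" by simp
  show ?thesis
    unfolding two_star_pmf_def by (rule pmf_embed_pmf[OF nonneg total])
qed

end

theory Submission
  imports Defs "HOL-Real_Asymp.Real_Asymp"
begin

text \<open>
  Write \<open>m = n - 1\<close>. Since twice the number of edges is the sum of the degrees \<open>d\<^sub>i\<close> and a vertex of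
  degree \<open>d\<close> is the centre of \<open>d (d - 1) / 2\<close> two stars, the exponent of the model is
  \<open>\<beta>\<^sub>2 / (2 m) (\<Sum>i. d\<^sub>i\<^sup>2) + \<beta>\<^sub>1 / 2 (\<Sum>i. d\<^sub>i)\<close>. The whole proof rests on one device. The square satisfies
  \<open>d\<^sup>2 \<ge> 2 m p d - m\<^sup>2 p\<^sup>2\<close>, with equality when \<open>d = m p\<close>, and once every square is replaced by its
  tangent the exponent is linear in the edges, so the sum over all graphs factorises. Used with a
  common \<open>p\<close> this bounds the normalising constant from below; used with \<open>p\<^sub>i = d\<^sub>i / m\<close> it bounds
  the total weight of the graphs with a prescribed degree sequence from above. Because
  \<open>u \<mapsto> ln (1 + exp u)\<close> is convex, the upper bound decouples over the vertices, and both bounds are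
  expressed by the same function
  \<open>G p = ln (1 + exp (\<beta>\<^sub>1 + 2 \<beta>\<^sub>2 p)) - \<beta>\<^sub>2 p\<^sup>2\<close> (\<open>mean_field\<close>): a degree sequence has probability at most
  \<open>exp (- m / 2 (\<Sum>i. G p\<^sub>0 - G (d\<^sub>i / m)))\<close>.

  In the spin variable \<open>2 p - 1\<close> the function \<open>G\<close> is the Curie--Weiss free energy, and on
  \<open>Theta1\<close> it has exactly one maximiser \<open>p\<^sub>0\<close>, which lies in the open unit interval
  (\<open>mean_field_maximizer\<close>). There are only \<open>n\<^sup>n\<close> degree sequences, which is negligible against
  \<open>exp (- c n\<^sup>2)\<close>; hence the average of \<open>\<bar>d\<^sub>i / m - p\<^sub>0\<bar>\<close> is small outside an event of probability
  \<open>exp (- c n\<^sup>2)\<close> (\<open>weight_of_degree_profiles_le\<close>).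

  This does not exclude a single exceptional vertex, whose cost \<open>exp (- c n)\<close> is swamped by the
  number of degree sequences. For that, fix the graph on the other vertices and resum only over the
  star of edges at vertex \<open>i\<close>. If the other degrees are on average close to \<open>m p\<^sub>0\<close>, the same
  linearisation applies to the star, and midpoint convexity shows that the cost of degree \<open>m p\<close> at
  \<open>i\<close> is at least \<open>m / 2 (G p\<^sub>0 - G p)\<close> up to a small multiple of \<open>n\<close>
  (\<open>single_vertex_deviation\<close>). Summing over the \<open>n\<close> possible degrees and the \<open>n\<close> vertices costs only a
  polynomial factor. Finally \<open>p\<^sub>0\<close> is unique because two limits would give two events of small
  probability that together cover everything.
\<close>

section \<open>The mean-field functional and its maximiser\<close>

definition softplus :: "real \<Rightarrow> real" where
  "softplus u = ln (1 + exp u)"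

text \<open>
  This is the free energy per pair of vertices after linearisation. It is the Legendre dual of the
  more familiar functional \<open>H p + \<beta>\<^sub>2 p\<^sup>2 + \<beta>\<^sub>1 p\<close> with \<open>H\<close> the binary entropy: both have the critical
  points \<open>p = 1 / (1 + exp (- \<beta>\<^sub>1 - 2 \<beta>\<^sub>2 p))\<close> and the same values there. The dual form is smooth up
  to and beyond the endpoints 0 and 1, so isolated and dominating vertices need no special treatment.
\<close>

definition mean_field :: "real \<Rightarrow> real \<Rightarrow> real \<Rightarrow> real" where
  "mean_field \<beta>\<^sub>1 \<beta>\<^sub>2 p = softplus (\<beta>\<^sub>1 + 2 * \<beta>\<^sub>2 * p) - \<beta>\<^sub>2 * p\<^sup>2"

lemma exp_softplus: "exp (softplus u) = 1 + exp u"
  by (simp add: softplus_def add_pos_pos)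

text \<open>
  After exponentiation and squaring this is the inequality
  \<open>2 exp ((a + b) / 2) \<le> exp a + exp b\<close>.
\<close>

lemma softplus_midpoint: "softplus ((a + b) / 2) \<le> (softplus a + softplus b) / 2"
proof -
  have "exp (2 * softplus ((a + b) / 2)) = (1 + exp ((a + b) / 2))\<^sup>2"
    by (simp add: exp_double exp_softplus)
  also have "\<dots> \<le> (1 + exp a) * (1 + exp b)"
  proof -
    have e: "(exp ((a + b) / 2))\<^sup>2 = exp a * exp b"
      by (simp add: exp_add [symmetric] power2_eq_square)
    have "0 \<le> (exp (a / 2) - exp (b / 2))\<^sup>2" by simp
    moreover have "(exp (a / 2))\<^sup>2 = exp a" "(exp (b / 2))\<^sup>2 = exp b"
      "exp (a / 2) * exp (b / 2) = exp ((a + b) / 2)"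
      by (simp_all add: exp_add [symmetric] power2_eq_square add_divide_distrib)
    ultimately show ?thesis using e by (simp add: power2_diff power2_sum algebra_simps)
  qed
  also have "\<dots> = exp (softplus a + softplus b)"
    by (simp add: exp_add exp_softplus)
  finally show ?thesis by simp
qed

lemma softplus_Lipschitz: "softplus a \<le> softplus b + \<bar>a - b\<bar>"
proof -
  have "exp (softplus a) \<le> exp (softplus b + \<bar>a - b\<bar>)"
  proof -
    have "exp a \<le> exp (b + \<bar>a - b\<bar>)" by simp
    moreover have "1 \<le> exp \<bar>a - b\<bar>" by simp
    ultimately show ?thesis by (simp add: exp_softplus exp_add distrib_right add_mono)
  qed
  then show ?thesis by simp
qed

definition spin_mean_field :: "real \<Rightarrow> real \<Rightarrow> real \<Rightarrow> real" where
  "spin_mean_field \<theta>\<^sub>1 \<theta>\<^sub>2 m = ln (cosh (\<theta>\<^sub>1 + 2 * \<theta>\<^sub>2 * m)) - \<theta>\<^sub>2 * m\<^sup>2"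

text \<open>
  The substitution \<open>m = 2 p - 1\<close> exposes the symmetry \<open>m \<mapsto> - m\<close> which governs the phase
  diagram; it rests on \<open>1 + exp (2 u) = 2 exp u cosh u\<close>.
\<close>

lemma mean_field_eq_spin_mean_field:
  "mean_field \<beta>\<^sub>1 \<beta>\<^sub>2 p
     = spin_mean_field ((\<beta>\<^sub>1 + \<beta>\<^sub>2) / 2) (\<beta>\<^sub>2 / 4) (2 * p - 1) + (\<beta>\<^sub>1 / 2 + \<beta>\<^sub>2 / 4 + ln 2)"
proof -
  define u where "u = \<beta>\<^sub>1 / 2 + \<beta>\<^sub>2 * p"
  have "1 + exp (2 * u) = 2 * exp u * cosh u"
    by (simp add: cosh_field_def exp_double exp_minus distrib_left power2_eq_square)
  then have "softplus (2 * u) = ln 2 + u + ln (cosh u)"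
    unfolding softplus_def by (simp add: ln_mult)
  moreover have "(\<beta>\<^sub>1 + \<beta>\<^sub>2) / 2 + 2 * (\<beta>\<^sub>2 / 4) * (2 * p - 1) = u" "\<beta>\<^sub>1 + 2 * \<beta>\<^sub>2 * p = 2 * u"
    by (simp_all add: u_def field_simps)
  ultimately have "mean_field \<beta>\<^sub>1 \<beta>\<^sub>2 p = ln 2 + u + ln (cosh u) - \<beta>\<^sub>2 * p\<^sup>2"
    "spin_mean_field ((\<beta>\<^sub>1 + \<beta>\<^sub>2) / 2) (\<beta>\<^sub>2 / 4) (2 * p - 1) = ln (cosh u) - \<beta>\<^sub>2 / 4 * (2 * p - 1)\<^sup>2"
    unfolding mean_field_def spin_mean_field_def by (simp_all only:)
  moreover have "\<beta>\<^sub>2 / 4 * (2 * p - 1)\<^sup>2 = \<beta>\<^sub>2 * p\<^sup>2 - \<beta>\<^sub>2 * p + \<beta>\<^sub>2 / 4"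
    by (simp add: power2_eq_square field_simps)
  ultimately show ?thesis unfolding u_def by linarith
qed

lemma spin_mean_field_deriv:
  "(spin_mean_field \<theta>\<^sub>1 \<theta>\<^sub>2 has_real_derivative 2 * \<theta>\<^sub>2 * (tanh (\<theta>\<^sub>1 + 2 * \<theta>\<^sub>2 * m) - m)) (at m)"
  unfolding spin_mean_field_def [abs_def]
  by (rule derivative_eq_intros refl | simp)+ (simp add: tanh_def field_simps)

lemma continuous_on_spin_mean_field: "continuous_on A (spin_mean_field \<theta>\<^sub>1 \<theta>\<^sub>2)"
  by (meson spin_mean_field_deriv DERIV_isCont continuous_at_imp_continuous_on)

lemma spin_mean_field_reflect: "spin_mean_field (- \<theta>\<^sub>1) \<theta>\<^sub>2 (- m) = spin_mean_field \<theta>\<^sub>1 \<theta>\<^sub>2 m"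
proof -
  have "- \<theta>\<^sub>1 + 2 * \<theta>\<^sub>2 * - m = - (\<theta>\<^sub>1 + 2 * \<theta>\<^sub>2 * m)" by simp
  then show ?thesis unfolding spin_mean_field_def by (simp only: cosh_minus power2_minus)
qed

text \<open>
  On the half line the derivative of \<open>D m = tanh (\<theta>\<^sub>1 + 2 \<theta>\<^sub>2 m) - m\<close> is strictly decreasing. Two zeros
  \<open>a < b\<close> would give, by Rolle, a zero of \<open>D'\<close> beyond \<open>a\<close>, so \<open>D\<close> would be strictly increasing on
  \<open>{0..a}\<close>. As \<open>D 0 = tanh \<theta>\<^sub>1 \<ge> 0\<close>, this forces \<open>a = 0\<close> and \<open>\<theta>\<^sub>1 = 0\<close>, where \<open>D' 0 = 2 \<theta>\<^sub>2 - 1 < 0\<close>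
  gives the contradiction: at zero field it is \<open>\<theta>\<^sub>2 < 1 / 2\<close> that excludes a nonzero fixed point.
\<close>

lemma tanh_fixed_point_unique:
  fixes a b \<theta>\<^sub>1 \<theta>\<^sub>2 :: real
  assumes \<theta>: "0 < \<theta>\<^sub>2" "0 < \<theta>\<^sub>1 \<or> \<theta>\<^sub>1 = 0 \<and> \<theta>\<^sub>2 < 1 / 2"
    and ab: "0 \<le> a" "0 \<le> b" "tanh (\<theta>\<^sub>1 + 2 * \<theta>\<^sub>2 * a) = a" "tanh (\<theta>\<^sub>1 + 2 * \<theta>\<^sub>2 * b) = b"
  shows "a = b"
  using ab
proof (induction a b rule: linorder_wlog)
  case (le a b)
  define D where "D m = tanh (\<theta>\<^sub>1 + 2 * \<theta>\<^sub>2 * m) - m" for m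
  define D' where "D' m = 2 * \<theta>\<^sub>2 * (1 - (tanh (\<theta>\<^sub>1 + 2 * \<theta>\<^sub>2 * m))\<^sup>2) - 1" for m
  have D: "(D has_real_derivative D' m) (at m)" for m
    unfolding D_def [abs_def] D'_def
    by (rule derivative_eq_intros refl | simp)+
  have cont: "continuous_on {u..v} D" for u v
    by (meson D DERIV_isCont continuous_at_imp_continuous_on)
  have D'_decr: "D' v < D' u" if "0 \<le> u" "u < v" for u v
  proof -
    have "0 \<le> tanh (\<theta>\<^sub>1 + 2 * \<theta>\<^sub>2 * u)" using that \<theta> by auto
    moreover have "tanh (\<theta>\<^sub>1 + 2 * \<theta>\<^sub>2 * u) < tanh (\<theta>\<^sub>1 + 2 * \<theta>\<^sub>2 * v)"
      using that \<theta> by simp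
    ultimately have "(tanh (\<theta>\<^sub>1 + 2 * \<theta>\<^sub>2 * u))\<^sup>2 < (tanh (\<theta>\<^sub>1 + 2 * \<theta>\<^sub>2 * v))\<^sup>2"
      by (intro power_strict_mono) auto
    then show ?thesis using \<theta>(1) by (simp add: D'_def)
  qed
  show ?case
  proof (rule ccontr)
    assume "a \<noteq> b"
    with le have "a < b" by simp
    moreover have "D a = 0" "D b = 0" using le by (simp_all add: D_def)
    ultimately have "\<exists>z>a. z < b \<and> (D has_real_derivative 0) (at z)"
      using D by (intro Rolle cont) (auto simp: real_differentiable_def)
    then obtain c where c: "a < c" "c < b" "D' c = 0"
      using D DERIV_unique by blast
    have pos: "0 < D' m" if "0 \<le> m" "m \<le> a" for m
      using D'_decr[of m c] that c by simp
    show False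
    proof (cases "a = 0")
      case True
      then have "\<theta>\<^sub>1 = 0" using le by simp
      then show False using pos[of 0] \<theta> True by (simp add: D'_def)
    next
      case False
      then have "0 < a" using le by simp
      then have "D 0 < D a"
        by (rule DERIV_pos_imp_increasing) (use D pos in blast)
      moreover have "0 \<le> D 0" using \<theta> by (auto simp: D_def)
      ultimately show False using \<open>D a = 0\<close> by simp
    qed
  qed
next
  case (sym a b)
  then show ?case by simp
qed

text \<open>
  Every maximiser is an interior critical point, that is, a fixed point of
  \<open>m \<mapsto> tanh (\<theta>\<^sub>1 + 2 \<theta>\<^sub>2 m)\<close>, because the derivative points inwards at both endpoints. For \<open>\<theta>\<^sub>1 > 0\<close>
  there may be further critical points on the negative side, but reflecting a negative \<open>m\<close> strictly
  increases the value; for \<open>\<theta>\<^sub>1 = 0\<close> the reflection of a negative maximiser would be a second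
  nonnegative fixed point next to 0. So all maximisers are nonnegative fixed points, of which there is
  only one.
\<close>

lemma spin_mean_field_maximizer_nonneg:
  assumes \<theta>: "0 < \<theta>\<^sub>2" "0 < \<theta>\<^sub>1 \<or> \<theta>\<^sub>1 = 0 \<and> \<theta>\<^sub>2 < 1 / 2"
  shows "\<exists>m\<^sub>0\<in>{-1<..<1}. \<forall>m\<in>{-1..1}. m \<noteq> m\<^sub>0 \<longrightarrow> spin_mean_field \<theta>\<^sub>1 \<theta>\<^sub>2 m < spin_mean_field \<theta>\<^sub>1 \<theta>\<^sub>2 m\<^sub>0"
proof -
  let ?K = "spin_mean_field \<theta>\<^sub>1 \<theta>\<^sub>2" and ?K' = "\<lambda>m. 2 * \<theta>\<^sub>2 * (tanh (\<theta>\<^sub>1 + 2 * \<theta>\<^sub>2 * m) - m)"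
  have max_critical: "m \<in> {-1<..<1} \<and> tanh (\<theta>\<^sub>1 + 2 * \<theta>\<^sub>2 * m) = m"
    if m: "m \<in> {-1..1}" and max: "\<forall>m'\<in>{-1..1}. ?K m' \<le> ?K m" for m
  proof -
    have "m \<noteq> 1"
    proof
      assume "m = 1"
      then have "?K' m < 0" using \<theta>(1) tanh_real_lt_1 by (simp add: mult_pos_neg)
      from DERIV_neg_dec_left[OF spin_mean_field_deriv this] obtain d
        where d: "d > 0" "\<forall>h>0. h < d \<longrightarrow> ?K m < ?K (m - h)" by blast
      have "?K m < ?K (m - min 1 (d / 2))" using d(1) by (intro d(2)[rule_format]) auto
      moreover have "m - min 1 (d / 2) \<in> {-1..1}" using d(1) \<open>m = 1\<close> by auto
      ultimately show False using max by fastforce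
    qed
    moreover have "m \<noteq> - 1"
    proof
      assume "m = - 1"
      then have "?K' m > 0" using \<theta>(1) tanh_real_gt_neg1[of "\<theta>\<^sub>1 + 2 * \<theta>\<^sub>2 * m"] by simp
      from DERIV_pos_inc_right[OF spin_mean_field_deriv this] obtain d
        where d: "d > 0" "\<forall>h>0. h < d \<longrightarrow> ?K m < ?K (m + h)" by blast
      have "?K m < ?K (m + min 1 (d / 2))" using d(1) by (intro d(2)[rule_format]) auto
      moreover have "m + min 1 (d / 2) \<in> {-1..1}" using d(1) \<open>m = - 1\<close> by auto
      ultimately show False using max by fastforce
    qed
    ultimately have int: "m \<in> {-1<..<1}" using m by auto
    have "?K' m = 0"
    proof (rule DERIV_local_max[OF spin_mean_field_deriv])
      show "0 < min (1 - m) (m + 1)" using int by auto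
      show "\<forall>y. \<bar>m - y\<bar> < min (1 - m) (m + 1) \<longrightarrow> ?K y \<le> ?K m"
      proof (intro allI impI)
        fix y assume "\<bar>m - y\<bar> < min (1 - m) (m + 1)"
        then have "y \<in> {-1..1}" by auto
        then show "?K y \<le> ?K m" using max by blast
      qed
    qed
    then show ?thesis using int \<theta>(1) by simp
  qed
  have max_nonneg: "0 \<le> m"
    if m: "m \<in> {-1..1}" and max: "\<forall>m'\<in>{-1..1}. ?K m' \<le> ?K m" for m
  proof (rule ccontr)
    assume neg: "\<not> 0 \<le> m"
    have "- m \<in> {-1..1}" using m by auto
    then have le: "?K (- m) \<le> ?K m" using max by blast
    from \<theta>(2) show False
    proof
      assume "0 < \<theta>\<^sub>1"
      moreover have "\<theta>\<^sub>2 * m < 0" using neg \<theta>(1) by (simp add: mult_pos_neg)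
      ultimately have "\<bar>\<theta>\<^sub>1 + 2 * \<theta>\<^sub>2 * m\<bar> < \<bar>\<theta>\<^sub>1 + 2 * \<theta>\<^sub>2 * - m\<bar>" by linarith
      then have "cosh \<bar>\<theta>\<^sub>1 + 2 * \<theta>\<^sub>2 * m\<bar> < cosh \<bar>\<theta>\<^sub>1 + 2 * \<theta>\<^sub>2 * - m\<bar>"
        by (subst cosh_real_nonneg_less_iff) simp_all
      then have "ln (cosh (\<theta>\<^sub>1 + 2 * \<theta>\<^sub>2 * m)) < ln (cosh (\<theta>\<^sub>1 + 2 * \<theta>\<^sub>2 * - m))"
        unfolding cosh_real_abs by (subst ln_less_cancel_iff) auto
      then show False using le by (simp add: spin_mean_field_def)
    next
      assume z: "\<theta>\<^sub>1 = 0 \<and> \<theta>\<^sub>2 < 1 / 2"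
      then have "\<theta>\<^sub>1 + 2 * \<theta>\<^sub>2 * - m = - (\<theta>\<^sub>1 + 2 * \<theta>\<^sub>2 * m)" by simp
      then have "tanh (\<theta>\<^sub>1 + 2 * \<theta>\<^sub>2 * - m) = - tanh (\<theta>\<^sub>1 + 2 * \<theta>\<^sub>2 * m)" by (simp only: tanh_minus)
      also have "\<dots> = - m" using max_critical[OF m max] by argo
      finally have "tanh (\<theta>\<^sub>1 + 2 * \<theta>\<^sub>2 * - m) = - m" .
      moreover have "0 \<le> - m" "tanh (\<theta>\<^sub>1 + 2 * \<theta>\<^sub>2 * 0) = 0" using neg z by simp_all
      ultimately have "- m = 0" using tanh_fixed_point_unique[OF \<theta>, of "- m" 0] by blast
      then show False using neg by simp
    qed
  qed
  obtain m\<^sub>0 where m\<^sub>0: "m\<^sub>0 \<in> {-1..1}" "\<forall>m\<in>{-1..1}. ?K m \<le> ?K m\<^sub>0"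
    using continuous_attains_sup[OF compact_Icc _ continuous_on_spin_mean_field, of "-1" 1] by fastforce
  show ?thesis
  proof (intro bexI ballI impI)
    show "m\<^sub>0 \<in> {-1<..<1}" using max_critical[OF m\<^sub>0] by blast
    fix m :: real assume m: "m \<in> {-1..1}" "m \<noteq> m\<^sub>0"
    show "?K m < ?K m\<^sub>0"
    proof (rule ccontr)
      assume "\<not> ?K m < ?K m\<^sub>0"
      then have max: "\<forall>m'\<in>{-1..1}. ?K m' \<le> ?K m" using m\<^sub>0(2) by (meson not_less order_trans)
      have "m = m\<^sub>0"
        using tanh_fixed_point_unique[OF \<theta> max_nonneg[OF m(1) max] max_nonneg[OF m\<^sub>0]]
          max_critical[OF m(1) max] max_critical[OF m\<^sub>0] by blast
      then show False using m(2) by simp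
    qed
  qed
qed

lemma spin_mean_field_maximizer:
  assumes "(\<theta>\<^sub>1, \<theta>\<^sub>2) \<in> Theta1"
  shows "\<exists>m\<^sub>0\<in>{-1<..<1}. \<forall>m\<in>{-1..1}. m \<noteq> m\<^sub>0 \<longrightarrow> spin_mean_field \<theta>\<^sub>1 \<theta>\<^sub>2 m < spin_mean_field \<theta>\<^sub>1 \<theta>\<^sub>2 m\<^sub>0"
proof (cases "\<theta>\<^sub>1 \<ge> 0")
  case True
  then show ?thesis using assms by (intro spin_mean_field_maximizer_nonneg) (auto simp: Theta1_def)
next
  case False
  then have "\<exists>m\<^sub>0\<in>{-1<..<1}. \<forall>m\<in>{-1..1}. m \<noteq> m\<^sub>0 \<longrightarrow> spin_mean_field (- \<theta>\<^sub>1) \<theta>\<^sub>2 m < spin_mean_field (- \<theta>\<^sub>1) \<theta>\<^sub>2 m\<^sub>0"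
    using assms by (intro spin_mean_field_maximizer_nonneg) (auto simp: Theta1_def)
  then obtain m\<^sub>0 where m\<^sub>0: "m\<^sub>0 \<in> {-1<..<1}"
    "\<And>m. m \<in> {-1..1} \<Longrightarrow> m \<noteq> m\<^sub>0 \<Longrightarrow> spin_mean_field (- \<theta>\<^sub>1) \<theta>\<^sub>2 m < spin_mean_field (- \<theta>\<^sub>1) \<theta>\<^sub>2 m\<^sub>0" by blast
  show ?thesis
  proof (intro bexI ballI impI)
    show "- m\<^sub>0 \<in> {-1<..<1}" using m\<^sub>0(1) by auto
    fix m assume "m \<in> {-1..1}" "m \<noteq> - m\<^sub>0"
    then show "spin_mean_field \<theta>\<^sub>1 \<theta>\<^sub>2 m < spin_mean_field \<theta>\<^sub>1 \<theta>\<^sub>2 (- m\<^sub>0)"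
      using m\<^sub>0(2)[of "- m"] spin_mean_field_reflect[of \<theta>\<^sub>1 \<theta>\<^sub>2 m] spin_mean_field_reflect[of \<theta>\<^sub>1 \<theta>\<^sub>2 "- m\<^sub>0"]
      by auto
  qed
qed

lemma mean_field_maximizer:
  assumes "((\<beta>\<^sub>1 + \<beta>\<^sub>2) / 2, \<beta>\<^sub>2 / 4) \<in> Theta1"
  obtains p\<^sub>0 where "p\<^sub>0 \<in> {0<..<1}"
    "\<And>p. p \<in> {0..1} \<Longrightarrow> p \<noteq> p\<^sub>0 \<Longrightarrow> mean_field \<beta>\<^sub>1 \<beta>\<^sub>2 p < mean_field \<beta>\<^sub>1 \<beta>\<^sub>2 p\<^sub>0"
proof -
  obtain m\<^sub>0 :: real where m\<^sub>0: "m\<^sub>0 \<in> {-1<..<1}" "\<And>m. m \<in> {-1..1} \<Longrightarrow> m \<noteq> m\<^sub>0 \<Longrightarrow>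
      spin_mean_field ((\<beta>\<^sub>1 + \<beta>\<^sub>2) / 2) (\<beta>\<^sub>2 / 4) m < spin_mean_field ((\<beta>\<^sub>1 + \<beta>\<^sub>2) / 2) (\<beta>\<^sub>2 / 4) m\<^sub>0"
    using spin_mean_field_maximizer[OF assms] by blast
  show ?thesis
  proof (rule that[of "(m\<^sub>0 + 1) / 2"])
    show "(m\<^sub>0 + 1) / 2 \<in> {0<..<1}" using m\<^sub>0(1) by auto
    fix p assume "p \<in> {0..1}" "p \<noteq> (m\<^sub>0 + 1) / 2"
    then have "2 * p - 1 \<in> {-1..1}" "2 * p - 1 \<noteq> m\<^sub>0" by (auto simp: field_simps)
    moreover have "2 * ((m\<^sub>0 + 1) / 2) - 1 = m\<^sub>0" by argo
    ultimately show "mean_field \<beta>\<^sub>1 \<beta>\<^sub>2 p < mean_field \<beta>\<^sub>1 \<beta>\<^sub>2 ((m\<^sub>0 + 1) / 2)"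
      unfolding mean_field_eq_spin_mean_field using m\<^sub>0(2)[of "2 * p - 1"] by simp
  qed
qed

text \<open>
  Compactness bounds \<open>f p\<^sub>0 - f p\<close> from below by some \<open>\<eta>\<close> at distance at least \<open>\<epsilon>\<close> from the maximiser.
  Putting the bound in the form \<open>\<eta> (\<bar>p - p\<^sub>0\<bar> - \<epsilon>)\<close>, which is weaker as distances in the unit interval
  are at most 1 and is void near \<open>p\<^sub>0\<close>, makes it linear in the deviation, so that it can be summed
  over the vertices.
\<close>

lemma strict_maximum_gap:
  fixes f :: "real \<Rightarrow> real"
  assumes cont: "continuous_on {0..1} f" and p\<^sub>0: "p\<^sub>0 \<in> {0..1}"
    and max: "\<And>p. p \<in> {0..1} \<Longrightarrow> p \<noteq> p\<^sub>0 \<Longrightarrow> f p < f p\<^sub>0" and "\<epsilon> > 0"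
  obtains \<eta> where "\<eta> > 0" "\<And>p. p \<in> {0..1} \<Longrightarrow> \<eta> * (\<bar>p - p\<^sub>0\<bar> - \<epsilon>) \<le> f p\<^sub>0 - f p"
proof -
  let ?A = "{0..1} - ball p\<^sub>0 \<epsilon>"
  have "\<exists>\<eta>>0. \<forall>p\<in>?A. \<eta> \<le> f p\<^sub>0 - f p"
  proof (cases "?A = {}")
    case False
    have "compact ?A" by (intro compact_diff) auto
    moreover have "continuous_on ?A f" by (rule continuous_on_subset[OF cont]) auto
    ultimately obtain q where q: "q \<in> ?A" "\<forall>p\<in>?A. f p \<le> f q"
      using continuous_attains_sup False by metis
    moreover have "q \<noteq> p\<^sub>0" using q(1) \<open>\<epsilon> > 0\<close> by auto
    ultimately show ?thesis
      using max[of q] by (intro exI[of _ "f p\<^sub>0 - f q"]) auto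
  qed (auto intro: exI[of _ 1])
  then obtain \<eta> where \<eta>: "\<eta> > 0" "\<And>p. p \<in> ?A \<Longrightarrow> \<eta> \<le> f p\<^sub>0 - f p" by blast
  have "\<eta> * (\<bar>p - p\<^sub>0\<bar> - \<epsilon>) \<le> f p\<^sub>0 - f p" if p: "p \<in> {0..1}" for p
  proof (cases "\<bar>p - p\<^sub>0\<bar> < \<epsilon>")
    case True
    then have "\<eta> * (\<bar>p - p\<^sub>0\<bar> - \<epsilon>) \<le> 0" using \<eta>(1) by (simp add: mult_pos_neg less_imp_le)
    also have "0 \<le> f p\<^sub>0 - f p" using max[OF p] by (cases "p = p\<^sub>0") auto
    finally show ?thesis .
  next
    case False
    have "\<eta> * (\<bar>p - p\<^sub>0\<bar> - \<epsilon>) \<le> \<eta> * 1"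
      using \<eta>(1) p p\<^sub>0 \<open>\<epsilon> > 0\<close> by (intro mult_left_mono) auto
    also have "\<dots> \<le> f p\<^sub>0 - f p" using \<eta>(2)[of p] p False by (auto simp: dist_real_def abs_minus_commute)
    finally show ?thesis .
  qed
  then show ?thesis using \<eta>(1) that by blast
qed

lemma continuous_on_mean_field: "continuous_on A (mean_field \<beta>\<^sub>1 \<beta>\<^sub>2)"
  unfolding mean_field_def [abs_def] softplus_def
  by (intro continuous_intros) (smt (verit) exp_gt_zero)

section \<open>The weight of a graph in terms of its degrees\<close>

text \<open>
  The partition function of independent edges: a sum over edge sets of a weight that is
  multiplicative over the edges is a product over the edges.
\<close>

lemma sum_Pow_exp_softplus:
  assumes "finite A"
  shows "(\<Sum>S\<in>Pow A. exp (\<Sum>e\<in>S. c e)) = exp (\<Sum>e\<in>A. softplus (c e))"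
proof -
  have "(\<Sum>S\<in>Pow A. exp (\<Sum>e\<in>S. c e)) = (\<Sum>S\<in>Pow A. (\<Prod>e\<in>S. exp (c e)) * (\<Prod>e\<in>A - S. 1))"
    using assms by (intro sum.cong refl) (auto simp: exp_sum finite_subset)
  also have "\<dots> = (\<Prod>e\<in>A. exp (c e) + 1)"
    using prod_add[OF assms, of "\<lambda>e. exp (c e)" "\<lambda>_. 1"] by simp
  also have "\<dots> = exp (\<Sum>e\<in>A. softplus (c e))"
    using assms by (simp add: exp_sum exp_softplus add.commute)
  finally show ?thesis .
qed

lemma sum_offdiagonal_symmetric:
  fixes f :: "nat \<Rightarrow> nat \<Rightarrow> 'a::comm_semiring_1"
  assumes "finite A" and sym: "\<And>i j. f i j = f j i"
  shows "(\<Sum>i\<in>A. \<Sum>j\<in>A - {i}. f i j) = 2 * (\<Sum>i\<in>A. \<Sum>j\<in>{j\<in>A. i < j}. f i j)"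
proof -
  have "(\<Sum>i\<in>A. \<Sum>j\<in>A - {i}. f i j)
      = (\<Sum>i\<in>A. (\<Sum>j\<in>{j\<in>A. i < j}. f i j) + (\<Sum>j\<in>{j\<in>A. j < i}. f i j))"
    using assms(1)
    by (intro sum.cong refl, subst sum.union_disjoint [symmetric]) (auto intro!: sum.cong)
  also have "\<dots> = (\<Sum>i\<in>A. \<Sum>j\<in>{j\<in>A. i < j}. f i j) + (\<Sum>i\<in>A. \<Sum>j\<in>{j\<in>A. j < i}. f j i)"
    by (simp add: sum.distrib sym)
  also have "(\<Sum>i\<in>A. \<Sum>j\<in>{j\<in>A. j < i}. f j i) = (\<Sum>j\<in>A. \<Sum>i\<in>{i\<in>A. j < i}. f j i)"
    using assms(1) by (rule sum.swap_restrict)  (rule assms(1))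
  finally show ?thesis by (simp add: mult_2)
qed

lemma sum_pairs_symmetric:
  fixes f :: "nat \<Rightarrow> nat \<Rightarrow> 'a::comm_semiring_1"
  assumes "\<And>i j. f i j = f j i"
  shows "(\<Sum>i\<in>{1..n}. \<Sum>j\<in>{1..n} - {i}. f i j) = 2 * (\<Sum>i\<in>{1..n}. \<Sum>j\<in>{i<..n}. f i j)"
proof -
  have "{j \<in> {1..n}. i < j} = {i<..n}" if "i \<in> {1..n}" for i
    using that by auto
  then have "(\<Sum>i\<in>{1..n}. \<Sum>j\<in>{j \<in> {1..n}. i < j}. f i j) = (\<Sum>i\<in>{1..n}. \<Sum>j\<in>{i<..n}. f i j)"
    by (intro sum.cong) auto
  then show ?thesis
    using sum_offdiagonal_symmetric [of "{1..n}" f] assms by simp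
qed

lemma square_sum_eq:
  fixes a :: "nat \<Rightarrow> nat"
  assumes "finite A" "\<And>j. a j \<in> {0, 1}"
  shows "(\<Sum>j\<in>A. a j)\<^sup>2 = (\<Sum>j\<in>A. a j) + 2 * (\<Sum>j\<in>A. \<Sum>l\<in>{l\<in>A. j < l}. a j * a l)"
proof -
  have "(\<Sum>j\<in>A. a j)\<^sup>2 = (\<Sum>j\<in>A. \<Sum>l\<in>A. a j * a l)"
    by (simp add: power2_eq_square sum_product)
  also have "\<dots> = (\<Sum>j\<in>A. a j * a j + (\<Sum>l\<in>A - {j}. a j * a l))"
    using assms(1) by (intro sum.cong refl sum.remove) auto
  also have "(\<Sum>j\<in>A. a j * a j + (\<Sum>l\<in>A - {j}. a j * a l))
     = (\<Sum>j\<in>A. a j) + (\<Sum>j\<in>A. \<Sum>l\<in>A - {j}. a j * a l)"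
  proof -
    have "a j * a j = a j" for j using assms(2)[of j] by auto
    then show ?thesis by (simp only: sum.distrib)
  qed
  also have "(\<Sum>j\<in>A. \<Sum>l\<in>A - {j}. a j * a l) = 2 * (\<Sum>j\<in>A. \<Sum>l\<in>{l\<in>A. j < l}. a j * a l)"
    by (rule sum_offdiagonal_symmetric) (use assms in auto)
  finally show ?thesis .
qed

lemma simple_graphsD:
  assumes "x \<in> simple_graphs n"
  shows "x i j \<in> {0, 1}" "x i j = x j i" "x i i = 0" "i \<notin> {1..n} \<or> j \<notin> {1..n} \<Longrightarrow> x i j = 0"
  using assms unfolding simple_graphs_def by blast+

lemma two_num_edges:
  assumes "x \<in> simple_graphs n"
  shows "2 * num_edges n x = (\<Sum>i\<in>{1..n}. vertex_degree n x i)"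
  unfolding num_edges_def vertex_degree_def
  by (rule sum_pairs_symmetric [symmetric]) (rule simple_graphsD(2)[OF assms])

text \<open>
  Each square \<open>d\<^sub>i\<^sup>2\<close> counts ordered pairs of edges at \<open>i\<close>: the diagonal pairs give \<open>d\<^sub>i\<close>, and the others
  count every two star centred at \<open>i\<close> twice.
\<close>

lemma two_num_two_stars:
  assumes "x \<in> simple_graphs n"
  shows "2 * num_two_stars n x + (\<Sum>i\<in>{1..n}. vertex_degree n x i)
    = (\<Sum>i\<in>{1..n}. (vertex_degree n x i)\<^sup>2)"
proof -
  have "(vertex_degree n x i)\<^sup>2
      = vertex_degree n x i + 2 * (\<Sum>j\<in>{1..n} - {i}. \<Sum>l\<in>{j<..n} - {i}. x i j * x i l)" for i
  proof -
    have "{l \<in> {1..n} - {i}. j < l} = {j<..n} - {i}" if "j \<in> {1..n} - {i}" for j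
      using that by auto
    then show ?thesis
      unfolding vertex_degree_def
      by (subst square_sum_eq) (use simple_graphsD(1)[OF assms] in auto)
  qed
  then show ?thesis
    by (simp add: num_two_stars_def sum.distrib sum_distrib_left)
qed

text \<open>
  The term \<open>\<beta>\<^sub>2 / (n - 1)\<close> in the coefficient of the edges in \<open>two_star_weight\<close> is exactly what cancels
  the linear part of \<open>d\<^sub>i (d\<^sub>i - 1) / 2\<close>.
\<close>

lemma two_star_weight_eq:
  assumes "x \<in> simple_graphs n"
  shows "two_star_weight n \<beta>\<^sub>1 \<beta>\<^sub>2 x
    = exp (\<beta>\<^sub>2 / (2 * (real n - 1)) * (\<Sum>i\<in>{1..n}. (real (vertex_degree n x i))\<^sup>2)
           + \<beta>\<^sub>1 / 2 * (\<Sum>i\<in>{1..n}. real (vertex_degree n x i)))"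
proof -
  define Q where "Q = (\<Sum>i\<in>{1..n}. (real (vertex_degree n x i))\<^sup>2)"
  define D where "D = (\<Sum>i\<in>{1..n}. real (vertex_degree n x i))"
  have "real (2 * num_edges n x) = D"
    unfolding two_num_edges[OF assms] D_def by simp
  then have E: "real (num_edges n x) = D / 2" by simp
  have "real (2 * num_two_stars n x + (\<Sum>i\<in>{1..n}. vertex_degree n x i)) = Q"
    unfolding two_num_two_stars[OF assms] Q_def by simp
  then have T: "real (num_two_stars n x) = (Q - D) / 2" by (simp add: D_def)
  have "r * ((Q - D) / 2) + (\<beta>\<^sub>1 + r) * (D / 2) = r / 2 * Q + \<beta>\<^sub>1 / 2 * D" for r
    by (simp add: algebra_simps diff_divide_distrib add_divide_distrib)
  from this [of "\<beta>\<^sub>2 / (real n - 1)"]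
  have "\<beta>\<^sub>2 / (real n - 1) * ((Q - D) / 2) + (\<beta>\<^sub>1 + \<beta>\<^sub>2 / (real n - 1)) * (D / 2)
      = \<beta>\<^sub>2 / (2 * (real n - 1)) * Q + \<beta>\<^sub>1 / 2 * D"
    by (simp add: divide_divide_eq_left mult.commute)
  then show ?thesis
    unfolding two_star_weight_def E T Q_def D_def by (rule arg_cong)
qed

definition vertex_pairs :: "nat \<Rightarrow> (nat \<times> nat) set" where
  "vertex_pairs n = (SIGMA i:{1..n}. {i<..n})"

lemma sum_vertex_pairs: "(\<Sum>(i, j)\<in>vertex_pairs n. f i j) = (\<Sum>i\<in>{1..n}. \<Sum>j\<in>{i<..n}. f i j)"
  unfolding vertex_pairs_def by (rule sum.Sigma [symmetric]) auto

lemma sum_degrees_eq: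
  fixes c :: "nat \<Rightarrow> real"
  assumes "x \<in> simple_graphs n"
  shows "(\<Sum>i\<in>{1..n}. c i * real (vertex_degree n x i))
    = (\<Sum>(i, j)\<in>vertex_pairs n. (c i + c j) * real (x i j))"
proof -
  let ?s = "\<lambda>f. \<Sum>i\<in>{1..n}. \<Sum>j\<in>{1..n} - {i}. f i j :: real"
  have sym: "x i j = x j i" for i j by (rule simple_graphsD(2)[OF assms])
  have L: "(\<Sum>i\<in>{1..n}. c i * real (vertex_degree n x i)) = ?s (\<lambda>i j. c i * real (x i j))"
    by (simp add: vertex_degree_def sum_distrib_left)
  have eq: "{j \<in> {1..n}. j \<noteq> i} = {1..n} - {i}" "{j \<in> {1..n}. i \<noteq> j} = {1..n} - {i}" for i :: nat
    by auto
  have "?s (\<lambda>i j. c j * real (x j i)) = ?s (\<lambda>i j. c i * real (x i j))"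
    using sum.swap_restrict[of "{1..n}" "{1..n}" "\<lambda>i j. c j * real (x j i)" "\<lambda>i j. i \<noteq> j"]
    by (simp only: eq finite_atLeastAtMost simp_thms)
  then have "?s (\<lambda>i j. c i * real (x i j) + c j * real (x j i)) = 2 * ?s (\<lambda>i j. c i * real (x i j))"
    by (simp only: sum.distrib mult_2)
  moreover have "c i * real (x i j) + c j * real (x j i) = (c i + c j) * real (x i j)" for i j
    using sym[of i j] by (simp add: distrib_right)
  ultimately have "2 * ?s (\<lambda>i j. c i * real (x i j)) = ?s (\<lambda>i j. (c i + c j) * real (x i j))"
    by simp
  also have "\<dots> = 2 * (\<Sum>i\<in>{1..n}. \<Sum>j\<in>{i<..n}. (c i + c j) * real (x i j))"
    by (rule sum_pairs_symmetric) (metis add.commute sym)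
  finally show ?thesis unfolding L sum_vertex_pairs by simp
qed

text \<open>
  A weight that is exponential in a linear function of the degrees makes the edges independent, the
  edge between \<open>i\<close> and \<open>j\<close> carrying the field \<open>c i + c j\<close>. Graphs are turned into subsets of the pairs
  \<open>i < j\<close> in order to use the product formula.
\<close>

lemma sum_graphs_exp_degrees:
  fixes c :: "nat \<Rightarrow> real"
  shows "(\<Sum>x\<in>simple_graphs n. exp (\<Sum>i\<in>{1..n}. c i * real (vertex_degree n x i)))
    = exp (\<Sum>i\<in>{1..n}. \<Sum>j\<in>{i<..n}. softplus (c i + c j))"
proof -
  let ?E = "vertex_pairs n"
  have fin: "finite ?E" by (simp add: vertex_pairs_def)
  have "(\<Sum>x\<in>simple_graphs n. exp (\<Sum>i\<in>{1..n}. c i * real (vertex_degree n x i)))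
      = (\<Sum>X\<in>Pow ?E. exp (\<Sum>e\<in>X. case e of (i, j) \<Rightarrow> c i + c j))"
  proof (rule sum.reindex_bij_witness [where
        i = "\<lambda>X i j. of_bool ((i, j) \<in> X \<or> (j, i) \<in> X)" and
        j = "\<lambda>x. {(i, j) \<in> ?E. x i j = 1}"])
    fix x assume x: "x \<in> simple_graphs n"
    note D = simple_graphsD[OF x]
    show "(\<lambda>i j. of_bool ((i, j) \<in> {(i, j) \<in> ?E. x i j = 1} \<or> (j, i) \<in> {(i, j) \<in> ?E. x i j = 1})) = x"
    proof (intro ext)
      fix i j
      have "x i j = 1 \<longrightarrow> (i, j) \<in> ?E \<or> (j, i) \<in> ?E"
        using D(3)[of i] D(4)[of i j]
        by (cases i j rule: linorder_cases; cases "i \<in> {1..n} \<and> j \<in> {1..n}") (auto simp: vertex_pairs_def)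
      then show "of_bool ((i, j) \<in> {(i, j) \<in> ?E. x i j = 1} \<or> (j, i) \<in> {(i, j) \<in> ?E. x i j = 1}) = x i j"
        using D(1,2)[of i j] by auto
    qed
    have "(\<Sum>i\<in>{1..n}. c i * real (vertex_degree n x i)) = (\<Sum>e\<in>?E. case e of (i, j) \<Rightarrow> (c i + c j) * real (x i j))"
      by (rule sum_degrees_eq[OF x])
    also have "\<dots> = (\<Sum>e\<in>{(i, j) \<in> ?E. x i j = 1}. case e of (i, j) \<Rightarrow> c i + c j)"
    proof (rule sum.mono_neutral_cong_right[OF fin])
      show "\<forall>e\<in>?E - {(i, j) \<in> ?E. x i j = 1}. (case e of (i, j) \<Rightarrow> (c i + c j) * real (x i j)) = 0"
      proof
        fix e assume e: "e \<in> ?E - {(i, j) \<in> ?E. x i j = 1}"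
        then show "(case e of (i, j) \<Rightarrow> (c i + c j) * real (x i j)) = 0"
          using D(1)[of "fst e" "snd e"] by (cases e) auto
      qed
    qed auto
    finally show "exp (\<Sum>e\<in>{(i, j) \<in> ?E. x i j = 1}. case e of (i, j) \<Rightarrow> c i + c j)
      = exp (\<Sum>i\<in>{1..n}. c i * real (vertex_degree n x i))" by simp
  next
    fix X assume X: "X \<in> Pow ?E"
    then show "(\<lambda>i j. of_bool ((i, j) \<in> X \<or> (j, i) \<in> X)) \<in> simple_graphs n"
      by (auto simp: simple_graphs_def vertex_pairs_def)
    show "{(i, j) \<in> ?E. of_bool ((i, j) \<in> X \<or> (j, i) \<in> X) = (1::nat)} = X"
      using X by (auto simp: vertex_pairs_def)
  qed auto
  also have "\<dots> = exp (\<Sum>e\<in>?E. softplus (case e of (i, j) \<Rightarrow> c i + c j))"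
    by (rule sum_Pow_exp_softplus[OF fin])
  also have "(\<Sum>e\<in>?E. softplus (case e of (i, j) \<Rightarrow> c i + c j))
      = (\<Sum>i\<in>{1..n}. \<Sum>j\<in>{i<..n}. softplus (c i + c j))"
    unfolding sum_vertex_pairs [symmetric] by (simp add: case_prod_unfold)
  finally show ?thesis .
qed

section \<open>Linearisation and the cost of a degree sequence\<close>

lemma sum_pairs_endpoints:
  fixes g :: "nat \<Rightarrow> real"
  shows "(\<Sum>i\<in>{1..n}. \<Sum>j\<in>{i<..n}. g i + g j) = (real n - 1) * (\<Sum>i\<in>{1..n}. g i)"
proof -
  have card: "real (card ({1..n} - {i})) = real n - 1" if "i \<in> {1..n}" for i
    using that by (subst card_Diff_singleton) (auto simp: of_nat_diff)
  have swap: "(\<Sum>j\<in>{1..n} - {i}. g j) = (\<Sum>j\<in>{1..n}. g j) - g i" if "i \<in> {1..n}" for i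
    using that by (simp add: sum_diff1)
  have "2 * (\<Sum>i\<in>{1..n}. \<Sum>j\<in>{i<..n}. g i + g j) = (\<Sum>i\<in>{1..n}. \<Sum>j\<in>{1..n} - {i}. g i + g j)"
    by (rule sum_pairs_symmetric [symmetric]) (simp add: add.commute)
  also have "\<dots> = (\<Sum>i\<in>{1..n}. (real n - 1) * g i + ((\<Sum>j\<in>{1..n}. g j) - g i))"
    by (intro sum.cong refl) (simp only: sum.distrib sum_constant card swap)
  also have "\<dots> = (real n - 1) * (\<Sum>i\<in>{1..n}. g i) + (real n * (\<Sum>i\<in>{1..n}. g i) - (\<Sum>i\<in>{1..n}. g i))"
    by (simp add: sum.distrib sum_subtractf sum_distrib_left)
  also have "\<dots> = 2 * ((real n - 1) * (\<Sum>i\<in>{1..n}. g i))"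
    by (simp add: left_diff_distrib)
  finally show ?thesis by simp
qed

text \<open>
  Midpoint convexity replaces the interaction \<open>softplus (c i + c j)\<close> by the average of two one-vertex
  terms, and each vertex occurs in \<open>n - 1\<close> pairs.
\<close>

lemma sum_graphs_exp_degrees_le:
  fixes c :: "nat \<Rightarrow> real"
  shows "(\<Sum>x\<in>simple_graphs n. exp (\<Sum>i\<in>{1..n}. c i * real (vertex_degree n x i)))
    \<le> exp ((real n - 1) / 2 * (\<Sum>i\<in>{1..n}. softplus (2 * c i)))"
proof -
  have "(\<Sum>i\<in>{1..n}. \<Sum>j\<in>{i<..n}. softplus (c i + c j))
      \<le> (\<Sum>i\<in>{1..n}. \<Sum>j\<in>{i<..n}. softplus (2 * c i) / 2 + softplus (2 * c j) / 2)"
  proof (intro sum_mono)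
    fix i j
    show "softplus (c i + c j) \<le> softplus (2 * c i) / 2 + softplus (2 * c j) / 2"
      using softplus_midpoint[of "2 * c i" "2 * c j"] by (simp add: add_divide_distrib)
  qed
  also have "\<dots> = (real n - 1) * (\<Sum>i\<in>{1..n}. softplus (2 * c i) / 2)"
    by (rule sum_pairs_endpoints)
  also have "\<dots> = (real n - 1) / 2 * (\<Sum>i\<in>{1..n}. softplus (2 * c i))"
    by (simp add: sum_divide_distrib [symmetric])
  finally show ?thesis
    unfolding sum_graphs_exp_degrees exp_le_cancel_iff .
qed

text \<open>
  The weight with every square \<open>d\<^sub>i\<^sup>2\<close> replaced by its tangent at \<open>(n - 1) p i\<close>.
\<close>

definition linear_weight :: "nat \<Rightarrow> real \<Rightarrow> real \<Rightarrow> (nat \<Rightarrow> real) \<Rightarrow> (nat \<Rightarrow> nat \<Rightarrow> nat) \<Rightarrow> real" where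
  "linear_weight n \<beta>\<^sub>1 \<beta>\<^sub>2 p x =
    exp (\<Sum>i\<in>{1..n}. (\<beta>\<^sub>1 / 2 + \<beta>\<^sub>2 * p i) * real (vertex_degree n x i))
      * exp (- ((real n - 1) / 2 * (\<beta>\<^sub>2 * (\<Sum>i\<in>{1..n}. (p i)\<^sup>2))))"

text \<open>
  The error of the tangent is itself a square. It vanishes when \<open>p i\<close> is the normalised degree of \<open>i\<close>,
  and dropping it gives a lower bound for the weight.
\<close>

lemma two_star_weight_eq_linear:
  assumes "x \<in> simple_graphs n" "n \<ge> 2"
  shows "two_star_weight n \<beta>\<^sub>1 \<beta>\<^sub>2 x = linear_weight n \<beta>\<^sub>1 \<beta>\<^sub>2 p x
    * exp (\<beta>\<^sub>2 / (2 * (real n - 1)) * (\<Sum>i\<in>{1..n}. (real (vertex_degree n x i) - (real n - 1) * p i)\<^sup>2))"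
proof -
  define M where "M = real n - 1"
  have M: "M > 0" using assms(2) by (simp add: M_def)
  define d where "d i = real (vertex_degree n x i)" for i
  have sq: "\<beta>\<^sub>2 / (2 * M) * (d i)\<^sup>2 + \<beta>\<^sub>1 / 2 * d i
      = (\<beta>\<^sub>1 / 2 + \<beta>\<^sub>2 * p i) * d i + - (M / 2 * (\<beta>\<^sub>2 * (p i)\<^sup>2)) + \<beta>\<^sub>2 / (2 * M) * (d i - M * p i)\<^sup>2" for i
    using M by (simp add: power2_eq_square field_simps)
  have "\<beta>\<^sub>2 / (2 * M) * (\<Sum>i\<in>{1..n}. (d i)\<^sup>2) + \<beta>\<^sub>1 / 2 * (\<Sum>i\<in>{1..n}. d i)
      = (\<Sum>i\<in>{1..n}. (\<beta>\<^sub>1 / 2 + \<beta>\<^sub>2 * p i) * d i) + - (M / 2 * (\<beta>\<^sub>2 * (\<Sum>i\<in>{1..n}. (p i)\<^sup>2)))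
        + \<beta>\<^sub>2 / (2 * M) * (\<Sum>i\<in>{1..n}. (d i - M * p i)\<^sup>2)"
    by (simp only: sum_distrib_left sum_negf [symmetric] sum.distrib [symmetric] sq)
  then show ?thesis
    unfolding two_star_weight_eq[OF assms(1)] linear_weight_def M_def [symmetric] d_def [symmetric]
    by (simp only: exp_add)
qed

lemma sum_linear_weight_le:
  "(\<Sum>x\<in>simple_graphs n. linear_weight n \<beta>\<^sub>1 \<beta>\<^sub>2 p x)
    \<le> exp ((real n - 1) / 2 * (\<Sum>i\<in>{1..n}. mean_field \<beta>\<^sub>1 \<beta>\<^sub>2 (p i)))"
proof -
  have "(\<Sum>x\<in>simple_graphs n. linear_weight n \<beta>\<^sub>1 \<beta>\<^sub>2 p x)
    \<le> exp ((real n - 1) / 2 * (\<Sum>i\<in>{1..n}. softplus (2 * (\<beta>\<^sub>1 / 2 + \<beta>\<^sub>2 * p i))))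
       * exp (- ((real n - 1) / 2 * (\<beta>\<^sub>2 * (\<Sum>i\<in>{1..n}. (p i)\<^sup>2))))"
    unfolding linear_weight_def sum_distrib_right [symmetric]
    by (intro mult_right_mono sum_graphs_exp_degrees_le) simp
  also have "\<dots> = exp ((real n - 1) / 2 * (\<Sum>i\<in>{1..n}. mean_field \<beta>\<^sub>1 \<beta>\<^sub>2 (p i)))"
  proof -
    have "(\<Sum>i\<in>{1..n}. mean_field \<beta>\<^sub>1 \<beta>\<^sub>2 (p i))
        = (\<Sum>i\<in>{1..n}. softplus (2 * (\<beta>\<^sub>1 / 2 + \<beta>\<^sub>2 * p i))) - \<beta>\<^sub>2 * (\<Sum>i\<in>{1..n}. (p i)\<^sup>2)"
      by (simp add: mean_field_def sum_subtractf sum_distrib_left distrib_left mult.assoc)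
    then show ?thesis by (simp only: right_diff_distrib exp_add [symmetric] diff_conv_add_uminus distrib_left mult_minus_right)
  qed
  finally show ?thesis .
qed

text \<open>
  With a common density \<open>p\<close> all edges of the linearised model carry the same field, so the midpoint
  inequality of the upper bound becomes an equality, and the tangents bound the weights from below.
\<close>

lemma two_star_Z_ge:
  assumes "\<beta>\<^sub>2 \<ge> 0" "n \<ge> 2"
  shows "exp ((real n - 1) / 2 * (real n * mean_field \<beta>\<^sub>1 \<beta>\<^sub>2 p)) \<le> two_star_Z n \<beta>\<^sub>1 \<beta>\<^sub>2"
proof -
  let ?c = "\<beta>\<^sub>1 / 2 + \<beta>\<^sub>2 * p"
  have "(\<Sum>i\<in>{1..n}. \<Sum>j\<in>{i<..n}. softplus (?c + ?c))
      = (\<Sum>i\<in>{1..n}. \<Sum>j\<in>{i<..n}. softplus (2 * ?c) / 2 + softplus (2 * ?c) / 2)"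
    by simp
  also have "\<dots> = (real n - 1) * (\<Sum>i\<in>{1..n}. softplus (2 * ?c) / 2)"
    by (rule sum_pairs_endpoints)
  finally have "(\<Sum>x\<in>simple_graphs n. linear_weight n \<beta>\<^sub>1 \<beta>\<^sub>2 (\<lambda>_. p) x)
      = exp ((real n - 1) / 2 * (real n * softplus (2 * ?c))) * exp (- ((real n - 1) / 2 * (\<beta>\<^sub>2 * (real n * p\<^sup>2))))"
    unfolding linear_weight_def sum_distrib_right [symmetric] sum_graphs_exp_degrees by simp
  also have "\<dots> = exp ((real n - 1) / 2 * (real n * mean_field \<beta>\<^sub>1 \<beta>\<^sub>2 p))"
  proof -
    have "real n * mean_field \<beta>\<^sub>1 \<beta>\<^sub>2 p = real n * softplus (2 * ?c) - \<beta>\<^sub>2 * (real n * p\<^sup>2)"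
      by (simp add: mean_field_def right_diff_distrib distrib_left mult.assoc mult.left_commute)
    then show ?thesis by (simp only: right_diff_distrib exp_add [symmetric] diff_conv_add_uminus distrib_left mult_minus_right)
  qed
  finally have "exp ((real n - 1) / 2 * (real n * mean_field \<beta>\<^sub>1 \<beta>\<^sub>2 p))
      = (\<Sum>x\<in>simple_graphs n. linear_weight n \<beta>\<^sub>1 \<beta>\<^sub>2 (\<lambda>_. p) x)" by simp
  also have "\<dots> \<le> two_star_Z n \<beta>\<^sub>1 \<beta>\<^sub>2"
    unfolding two_star_Z_def
  proof (rule sum_mono)
    fix x assume x: "x \<in> simple_graphs n"
    have "0 \<le> \<beta>\<^sub>2 / (2 * (real n - 1)) * (\<Sum>i\<in>{1..n}. (real (vertex_degree n x i) - (real n - 1) * p)\<^sup>2)"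
      using assms by (intro mult_nonneg_nonneg sum_nonneg) auto
    then have "linear_weight n \<beta>\<^sub>1 \<beta>\<^sub>2 (\<lambda>_. p) x * 1 \<le> two_star_weight n \<beta>\<^sub>1 \<beta>\<^sub>2 x"
      unfolding two_star_weight_eq_linear[OF x assms(2), of _ _ "\<lambda>_. p"]
      by (intro mult_left_mono) (simp_all only: one_le_exp_iff linear_weight_def exp_ge_zero mult_nonneg_nonneg)
    then show "linear_weight n \<beta>\<^sub>1 \<beta>\<^sub>2 (\<lambda>_. p) x \<le> two_star_weight n \<beta>\<^sub>1 \<beta>\<^sub>2 x" by simp
  qed
  finally show ?thesis .
qed

lemma vertex_degree_le:
  assumes "x \<in> simple_graphs n" "i \<in> {1..n}"
  shows "vertex_degree n x i \<le> n - 1"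
proof -
  have "x i j \<le> 1" for j using simple_graphsD(1)[OF assms(1), of i j] by auto
  then have "vertex_degree n x i \<le> card ({1..n} - {i}) * 1"
    unfolding vertex_degree_def by (intro sum_bounded_above [where 'a = nat, simplified]) auto
  then show ?thesis using assms(2) by simp
qed

text \<open>
  A graph in the sum is weighted exactly by the linearisation at its own degree profile, hence by at
  most the sum of the linearisations at all profiles with the property \<open>P\<close>. Exchanging the two sums,
  every profile contributes at most \<open>exp (- (n - 1) / 2 L)\<close> times the normalising constant, and there
  are at most \<open>n ^ n\<close> of them. The last hypothesis says that \<open>P\<close> depends only on the values at the
  vertices, so that profiles may be taken from a finite function space.
\<close>

lemma weight_of_degree_profiles_le:
  assumes n: "n \<ge> 2" and "\<beta>\<^sub>2 \<ge> 0"
    and far: "\<And>p. (\<And>i. i \<in> {1..n} \<Longrightarrow> p i \<in> {0..1}) \<Longrightarrow> P p \<Longrightarrow>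
      L \<le> (\<Sum>i\<in>{1..n}. mean_field \<beta>\<^sub>1 \<beta>\<^sub>2 p\<^sub>0 - mean_field \<beta>\<^sub>1 \<beta>\<^sub>2 (p i))"
    and ext: "\<And>p p'. (\<And>i. i \<in> {1..n} \<Longrightarrow> p i = p' i) \<Longrightarrow> P p \<Longrightarrow> P p'"
  shows "(\<Sum>x\<in>{x \<in> simple_graphs n. P (\<lambda>i. real (vertex_degree n x i) / (real n - 1))}.
            two_star_weight n \<beta>\<^sub>1 \<beta>\<^sub>2 x)
     \<le> real (n ^ n) * exp (- (real n - 1) / 2 * L) * two_star_Z n \<beta>\<^sub>1 \<beta>\<^sub>2"
proof -
  define M where "M = real n - 1"
  have M: "M > 0" using n by (simp add: M_def)
  let ?G = "mean_field \<beta>\<^sub>1 \<beta>\<^sub>2"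
  define D where "D = {d \<in> {1..n} \<rightarrow>\<^sub>E {0..n - 1}. P (\<lambda>i. real (d i) / M)}"
  let ?p = "\<lambda>d i. real (d i) / M"
  have fin: "finite ({1..n} \<rightarrow>\<^sub>E {0..n - 1})" by (intro finite_PiE) auto
  then have finD: "finite D" by (simp add: D_def)
  have cardD: "card D \<le> n ^ n"
  proof -
    have "card D \<le> card ({1..n} \<rightarrow>\<^sub>E {0..n - 1})"
      unfolding D_def by (rule card_mono[OF fin]) auto
    also have "\<dots> = n ^ n" using n by (simp add: card_PiE)
    finally show ?thesis .
  qed
  have nonneg: "0 \<le> linear_weight n \<beta>\<^sub>1 \<beta>\<^sub>2 p x" for p x by (simp add: linear_weight_def)
  let ?B = "{x \<in> simple_graphs n. P (\<lambda>i. real (vertex_degree n x i) / M)}"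
  have "(\<Sum>x\<in>?B. two_star_weight n \<beta>\<^sub>1 \<beta>\<^sub>2 x) \<le> (\<Sum>x\<in>?B. \<Sum>d\<in>D. linear_weight n \<beta>\<^sub>1 \<beta>\<^sub>2 (?p d) x)"
  proof (rule sum_mono)
    fix x assume "x \<in> ?B"
    then have x: "x \<in> simple_graphs n" and bad: "P (\<lambda>i. real (vertex_degree n x i) / M)" by auto
    define d where "d = restrict (vertex_degree n x) {1..n}"
    have "d \<in> D"
      using vertex_degree_le[OF x] ext[OF _ bad, of "?p d"] by (auto simp: D_def d_def)
    have "two_star_weight n \<beta>\<^sub>1 \<beta>\<^sub>2 x = linear_weight n \<beta>\<^sub>1 \<beta>\<^sub>2 (?p d) x"
      using M by (simp add: two_star_weight_eq_linear[OF x n, of _ _ "?p d"] M_def [symmetric] d_def)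
    also have "\<dots> \<le> (\<Sum>d\<in>D. linear_weight n \<beta>\<^sub>1 \<beta>\<^sub>2 (?p d) x)"
      by (rule member_le_sum) (use \<open>d \<in> D\<close> nonneg finD in auto)
    finally show "two_star_weight n \<beta>\<^sub>1 \<beta>\<^sub>2 x \<le> (\<Sum>d\<in>D. linear_weight n \<beta>\<^sub>1 \<beta>\<^sub>2 (?p d) x)" .
  qed
  also have "\<dots> \<le> (\<Sum>x\<in>simple_graphs n. \<Sum>d\<in>D. linear_weight n \<beta>\<^sub>1 \<beta>\<^sub>2 (?p d) x)"
    by (intro sum_mono2 sum_nonneg nonneg finite_simple_graphs) auto
  also have "\<dots> = (\<Sum>d\<in>D. \<Sum>x\<in>simple_graphs n. linear_weight n \<beta>\<^sub>1 \<beta>\<^sub>2 (?p d) x)"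
    by (rule sum.swap)
  also have "\<dots> \<le> (\<Sum>d\<in>D. exp (- M / 2 * L) * two_star_Z n \<beta>\<^sub>1 \<beta>\<^sub>2)"
  proof (rule sum_mono)
    fix d assume d: "d \<in> D"
    have "real (d i) \<le> M" if "i \<in> {1..n}" for i
    proof -
      have "d i \<le> n - 1" using d that by (auto simp: D_def)
      then show ?thesis using n unfolding M_def by linarith
    qed
    then have "?p d i \<in> {0..1}" if "i \<in> {1..n}" for i
      using that M by simp
    then have "L \<le> (\<Sum>i\<in>{1..n}. ?G p\<^sub>0 - ?G (?p d i))"
      using d by (intro far) (auto simp: D_def)
    then have *: "(\<Sum>i\<in>{1..n}. ?G (?p d i)) \<le> real n * ?G p\<^sub>0 - L" by (simp add: sum_subtractf)
    have "(\<Sum>x\<in>simple_graphs n. linear_weight n \<beta>\<^sub>1 \<beta>\<^sub>2 (?p d) x)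
        \<le> exp (M / 2 * (\<Sum>i\<in>{1..n}. ?G (?p d i)))"
      using sum_linear_weight_le[of n \<beta>\<^sub>1 \<beta>\<^sub>2 "?p d"] by (simp only: M_def)
    also have "\<dots> \<le> exp (M / 2 * (real n * ?G p\<^sub>0 - L))"
      using M * by (simp add: mult_left_mono)
    also have "\<dots> = exp (- M / 2 * L) * exp (M / 2 * (real n * ?G p\<^sub>0))"
      by (simp add: exp_add [symmetric] algebra_simps)
    also have "\<dots> \<le> exp (- M / 2 * L) * two_star_Z n \<beta>\<^sub>1 \<beta>\<^sub>2"
      using two_star_Z_ge[OF assms(2) n, of \<beta>\<^sub>1 p\<^sub>0] by (intro mult_left_mono) (simp_all add: M_def)
    finally show "(\<Sum>x\<in>simple_graphs n. linear_weight n \<beta>\<^sub>1 \<beta>\<^sub>2 (?p d) x) \<le> exp (- M / 2 * L) * two_star_Z n \<beta>\<^sub>1 \<beta>\<^sub>2" .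
  qed
  also have "\<dots> = real (card D) * (exp (- M / 2 * L) * two_star_Z n \<beta>\<^sub>1 \<beta>\<^sub>2)"
    by simp
  also have "\<dots> \<le> real (n ^ n) * (exp (- M / 2 * L) * two_star_Z n \<beta>\<^sub>1 \<beta>\<^sub>2)"
    using cardD two_star_Z_pos[of n \<beta>\<^sub>1 \<beta>\<^sub>2] by (intro mult_right_mono) (auto simp del: of_nat_power)
  finally show ?thesis by (simp add: M_def mult.assoc)
qed

section \<open>The cost of the degree of a single vertex\<close>

text \<open>
  The analogue of \<open>two_star_weight_eq_linear\<close> for the edges at one vertex: \<open>S\<close> is its neighbourhood,
  \<open>b (card S)\<^sup>2 / (2 m)\<close> comes from its own degree, and the field \<open>h j\<close> from the degree of the other
  endpoint \<open>j\<close>.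
\<close>

lemma star_weight_eq_linear:
  fixes h :: "'a \<Rightarrow> real"
  assumes "m > 0"
  shows "exp (b / (2 * m) * (real (card S))\<^sup>2 + (\<Sum>j\<in>S. h j))
    = exp (\<Sum>j\<in>S. h j + b * q) * exp (- (b * q\<^sup>2 * m / 2)) * exp (b / (2 * m) * (real (card S) - m * q)\<^sup>2)"
proof -
  define c where "c = real (card S)"
  have "b / (2 * m) * c\<^sup>2 = c * (b * q) - b * q\<^sup>2 * m / 2 + b / (2 * m) * (c - m * q)\<^sup>2"
    using assms by (simp add: power2_eq_square field_simps)
  moreover have "(\<Sum>j\<in>S. h j + b * q) = (\<Sum>j\<in>S. h j) + c * (b * q)"
    by (simp add: sum.distrib c_def)
  ultimately show ?thesis
    unfolding c_def [symmetric] exp_add [symmetric] by (intro arg_cong[where f = exp]) linarith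
qed

lemma sum_linear_star_weight:
  fixes h :: "'a \<Rightarrow> real"
  assumes "finite J"
  shows "(\<Sum>S\<in>Pow J. exp (\<Sum>j\<in>S. h j + b * q) * exp (- (b * q\<^sup>2 * m / 2)))
    = exp ((\<Sum>j\<in>J. softplus (h j + b * q)) - b * q\<^sup>2 * m / 2)"
proof -
  define r where "r = b * q\<^sup>2 * m / 2"
  have "(\<Sum>S\<in>Pow J. exp (\<Sum>j\<in>S. h j + b * q) * exp (- r))
      = (\<Sum>S\<in>Pow J. exp (\<Sum>j\<in>S. h j + b * q)) * exp (- r)"
    by (rule sum_distrib_right [symmetric])
  also have "\<dots> = exp (\<Sum>j\<in>J. softplus (h j + b * q)) * exp (- r)"
    by (simp only: sum_Pow_exp_softplus[OF assms])
  also have "\<dots> = exp ((\<Sum>j\<in>J. softplus (h j + b * q)) - r)"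
    by (simp add: exp_diff exp_minus field_simps)
  finally show ?thesis unfolding r_def .
qed

lemma star_partition_ge:
  fixes h :: "'a \<Rightarrow> real"
  assumes "finite J" "m > 0" "b \<ge> 0"
  shows "exp ((\<Sum>j\<in>J. softplus (h j + b * q)) - b * q\<^sup>2 * m / 2)
    \<le> (\<Sum>S\<in>Pow J. exp (b / (2 * m) * (real (card S))\<^sup>2 + (\<Sum>j\<in>S. h j)))"
  unfolding sum_linear_star_weight[OF assms(1), of h b q m, symmetric]
proof (rule sum_mono)
  fix S :: "'a set"
  have "0 \<le> b / (2 * m) * (real (card S) - m * q)\<^sup>2" using assms by simp
  then have "exp (\<Sum>j\<in>S. h j + b * q) * exp (- (b * q\<^sup>2 * m / 2)) * 1
      \<le> exp (b / (2 * m) * (real (card S))\<^sup>2 + (\<Sum>j\<in>S. h j))"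
    unfolding star_weight_eq_linear[OF assms(2), of b S h q]
    by (intro mult_left_mono) (simp_all only: one_le_exp_iff exp_ge_zero mult_nonneg_nonneg)
  then show "exp (\<Sum>j\<in>S. h j + b * q) * exp (- (b * q\<^sup>2 * m / 2))
      \<le> exp (b / (2 * m) * (real (card S))\<^sup>2 + (\<Sum>j\<in>S. h j))" by simp
qed

lemma star_partition_restricted_le:
  fixes h :: "'a \<Rightarrow> real"
  assumes "finite J" "m > 0" "finite D"
  shows "(\<Sum>S\<in>{S\<in>Pow J. card S \<in> D}. exp (b / (2 * m) * (real (card S))\<^sup>2 + (\<Sum>j\<in>S. h j)))
    \<le> (\<Sum>d\<in>D. exp ((\<Sum>j\<in>J. softplus (h j + b * (real d / m))) - b * (real d / m)\<^sup>2 * m / 2))"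
proof -
  define w where "w d S = exp (\<Sum>j\<in>S. h j + b * (real d / m)) * exp (- (b * (real d / m)\<^sup>2 * m / 2))"
    for d :: nat and S
  have nonneg: "0 \<le> w d S" for d S by (simp add: w_def)
  have "(\<Sum>S\<in>{S\<in>Pow J. card S \<in> D}. exp (b / (2 * m) * (real (card S))\<^sup>2 + (\<Sum>j\<in>S. h j)))
      = (\<Sum>S\<in>{S\<in>Pow J. card S \<in> D}. w (card S) S)"
  proof (rule sum.cong)
    fix S
    show "exp (b / (2 * m) * (real (card S))\<^sup>2 + (\<Sum>j\<in>S. h j)) = w (card S) S"
      unfolding star_weight_eq_linear[OF assms(2), of b S h "real (card S) / m"] w_def
      using assms(2) by simp
  qed simp
  also have "\<dots> \<le> (\<Sum>S\<in>{S\<in>Pow J. card S \<in> D}. \<Sum>d\<in>D. w d S)"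
    by (intro sum_mono member_le_sum) (use nonneg assms(3) in auto)
  also have "\<dots> \<le> (\<Sum>S\<in>Pow J. \<Sum>d\<in>D. w d S)"
    using assms(1) by (intro sum_mono2 sum_nonneg nonneg) auto
  also have "\<dots> = (\<Sum>d\<in>D. \<Sum>S\<in>Pow J. w d S)" by (rule sum.swap)
  finally show ?thesis unfolding w_def sum_linear_star_weight[OF assms(1)] .
qed

text \<open>
  Here \<open>t j\<close> stands for the normalised degree of \<open>j\<close>, and \<open>\<tau>\<close> bounds the total distance of these from
  \<open>p\<^sub>0\<close>. Since \<open>softplus\<close> is Lipschitz, replacing all \<open>t j\<close> by \<open>p\<^sub>0\<close> costs at most \<open>b \<tau>\<close> in the exponents
  of both the upper and the lower bound. What remains is
  \<open>F q = softplus (\<beta>\<^sub>1 + b p\<^sub>0 + b q) - b q\<^sup>2 / 2\<close>, the free energy of a vertex of density \<open>q\<close> in an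
  environment of density \<open>p\<^sub>0\<close>. It could a priori have a maximiser other than \<open>p\<^sub>0\<close>, but midpoint
  convexity gives \<open>F p\<^sub>0 - F q \<ge> (G p\<^sub>0 - G q) / 2\<close> with \<open>G\<close> the mean-field functional, so the gap of \<open>G\<close>
  is inherited.
\<close>

lemma star_degree_deviation:
  fixes t :: "'a \<Rightarrow> real"
  assumes J: "finite J" "m = real (card J)" "m > 0" and b: "b \<ge> 0" and D: "finite D"
    and close: "(\<Sum>j\<in>J. \<bar>t j - p\<^sub>0\<bar>) \<le> \<tau>"
    and far: "\<And>d. d \<in> D \<Longrightarrow> \<kappa> \<le> mean_field \<beta>\<^sub>1 b p\<^sub>0 - mean_field \<beta>\<^sub>1 b (real d / m)"
  defines "W \<equiv> \<lambda>S. exp (b / (2 * m) * (real (card S))\<^sup>2 + (\<Sum>j\<in>S. \<beta>\<^sub>1 + b * t j))"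
  shows "(\<Sum>S\<in>{S\<in>Pow J. card S \<in> D}. W S)
    \<le> real (card D) * exp (2 * b * \<tau> - m / 2 * \<kappa>) * (\<Sum>S\<in>Pow J. W S)"
proof -
  let ?s = "\<lambda>q. \<Sum>j\<in>J. softplus (\<beta>\<^sub>1 + b * t j + b * q)"
  let ?G = "mean_field \<beta>\<^sub>1 b"
  have err: "(\<Sum>j\<in>J. b * \<bar>t j - p\<^sub>0\<bar>) \<le> b * \<tau>"
    unfolding sum_distrib_left [symmetric] by (rule mult_left_mono[OF close b])
  have dist: "\<bar>(\<beta>\<^sub>1 + b * t j + b * q) - (\<beta>\<^sub>1 + b * p\<^sub>0 + b * q)\<bar> = b * \<bar>t j - p\<^sub>0\<bar>" for j q
  proof -
    have "(\<beta>\<^sub>1 + b * t j + b * q) - (\<beta>\<^sub>1 + b * p\<^sub>0 + b * q) = b * (t j - p\<^sub>0)"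
      by (simp add: right_diff_distrib)
    then show ?thesis using b by (simp only: abs_mult abs_of_nonneg)
  qed
  have upper: "?s q \<le> m * softplus (\<beta>\<^sub>1 + b * p\<^sub>0 + b * q) + b * \<tau>" for q
  proof -
    have "?s q \<le> (\<Sum>j\<in>J. softplus (\<beta>\<^sub>1 + b * p\<^sub>0 + b * q) + b * \<bar>t j - p\<^sub>0\<bar>)"
    proof (rule sum_mono)
      fix j
      show "softplus (\<beta>\<^sub>1 + b * t j + b * q) \<le> softplus (\<beta>\<^sub>1 + b * p\<^sub>0 + b * q) + b * \<bar>t j - p\<^sub>0\<bar>"
        unfolding dist [of j q, symmetric] by (rule softplus_Lipschitz)
    qed
    also have "\<dots> = m * softplus (\<beta>\<^sub>1 + b * p\<^sub>0 + b * q) + (\<Sum>j\<in>J. b * \<bar>t j - p\<^sub>0\<bar>)"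
      by (simp add: sum.distrib J(2))
    finally show ?thesis using err by linarith
  qed
  have lower: "m * softplus (\<beta>\<^sub>1 + b * p\<^sub>0 + b * q) - b * \<tau> \<le> ?s q" for q
  proof -
    have "m * softplus (\<beta>\<^sub>1 + b * p\<^sub>0 + b * q) = (\<Sum>j\<in>J. softplus (\<beta>\<^sub>1 + b * p\<^sub>0 + b * q))"
      by (simp add: J(2))
    also have "\<dots> \<le> (\<Sum>j\<in>J. softplus (\<beta>\<^sub>1 + b * t j + b * q) + b * \<bar>t j - p\<^sub>0\<bar>)"
    proof (rule sum_mono)
      fix j
      show "softplus (\<beta>\<^sub>1 + b * p\<^sub>0 + b * q) \<le> softplus (\<beta>\<^sub>1 + b * t j + b * q) + b * \<bar>t j - p\<^sub>0\<bar>"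
        unfolding dist [of j q, symmetric] abs_minus_commute [of "\<beta>\<^sub>1 + b * t j + b * q"]
        by (rule softplus_Lipschitz)
    qed
    also have "\<dots> = ?s q + (\<Sum>j\<in>J. b * \<bar>t j - p\<^sub>0\<bar>)"
      by (simp add: sum.distrib)
    finally show ?thesis using err by linarith
  qed
  define F where "F q = softplus (\<beta>\<^sub>1 + b * p\<^sub>0 + b * q) - b * q\<^sup>2 / 2" for q
  have Fp\<^sub>0: "F p\<^sub>0 = ?G p\<^sub>0 + b * p\<^sub>0\<^sup>2 / 2"
  proof -
    have "\<beta>\<^sub>1 + 2 * b * p\<^sub>0 = \<beta>\<^sub>1 + b * p\<^sub>0 + b * p\<^sub>0" by simp
    then have "softplus (\<beta>\<^sub>1 + 2 * b * p\<^sub>0) = softplus (\<beta>\<^sub>1 + b * p\<^sub>0 + b * p\<^sub>0)" by (rule arg_cong)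
    then show ?thesis unfolding F_def mean_field_def by linarith
  qed
  have F_le: "F q \<le> (?G q + ?G p\<^sub>0) / 2 + b * p\<^sub>0\<^sup>2 / 2" for q
  proof -
    have "(\<beta>\<^sub>1 + 2 * b * p\<^sub>0 + (\<beta>\<^sub>1 + 2 * b * q)) / 2 = \<beta>\<^sub>1 + b * p\<^sub>0 + b * q" by simp
    then have "softplus (\<beta>\<^sub>1 + b * p\<^sub>0 + b * q)
        \<le> (softplus (\<beta>\<^sub>1 + 2 * b * p\<^sub>0) + softplus (\<beta>\<^sub>1 + 2 * b * q)) / 2"
      using softplus_midpoint[of "\<beta>\<^sub>1 + 2 * b * p\<^sub>0" "\<beta>\<^sub>1 + 2 * b * q"] by (simp only:)
    then show ?thesis unfolding F_def mean_field_def by argo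
  qed
  have mF: "m * F q = m * softplus (\<beta>\<^sub>1 + b * p\<^sub>0 + b * q) - b * q\<^sup>2 * m / 2" for q
    by (simp add: F_def right_diff_distrib)
  have Z: "exp (m * F p\<^sub>0 - b * \<tau>) \<le> (\<Sum>S\<in>Pow J. W S)"
  proof -
    have "m * F p\<^sub>0 - b * \<tau> \<le> ?s p\<^sub>0 - b * p\<^sub>0\<^sup>2 * m / 2"
      using lower[of p\<^sub>0] mF[of p\<^sub>0] by linarith
    then have "exp (m * F p\<^sub>0 - b * \<tau>) \<le> exp (?s p\<^sub>0 - b * p\<^sub>0\<^sup>2 * m / 2)" by simp
    also have "\<dots> \<le> (\<Sum>S\<in>Pow J. W S)"
      unfolding W_def by (rule star_partition_ge[OF J(1,3) b])
    finally show ?thesis .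
  qed
  have "(\<Sum>S\<in>{S\<in>Pow J. card S \<in> D}. W S)
      \<le> (\<Sum>d\<in>D. exp (?s (real d / m) - b * (real d / m)\<^sup>2 * m / 2))"
    unfolding W_def by (rule star_partition_restricted_le[OF J(1,3) D])
  also have "\<dots> \<le> (\<Sum>d\<in>D. exp (2 * b * \<tau> - m / 2 * \<kappa>) * (\<Sum>S\<in>Pow J. W S))"
  proof (rule sum_mono)
    fix d assume d: "d \<in> D"
    define q where "q = real d / m"
    have "?s q - b * q\<^sup>2 * m / 2 \<le> m * F q + b * \<tau>"
      using upper[of q] mF[of q] by linarith
    moreover have "m * F q \<le> m * (F p\<^sub>0 - \<kappa> / 2)"
    proof (rule mult_left_mono)
      show "F q \<le> F p\<^sub>0 - \<kappa> / 2"
        using F_le[of q] Fp\<^sub>0 far[OF d, folded q_def] by argo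
    qed (use J(3) in simp)
    moreover have "m * (F p\<^sub>0 - \<kappa> / 2) = m * F p\<^sub>0 - m / 2 * \<kappa>" by (simp add: right_diff_distrib)
    ultimately have "?s q - b * q\<^sup>2 * m / 2 \<le> (2 * b * \<tau> - m / 2 * \<kappa>) + (m * F p\<^sub>0 - b * \<tau>)"
      by linarith
    then have "exp (?s q - b * q\<^sup>2 * m / 2) \<le> exp (2 * b * \<tau> - m / 2 * \<kappa>) * exp (m * F p\<^sub>0 - b * \<tau>)"
      unfolding exp_add [symmetric] exp_le_cancel_iff .
    also have "\<dots> \<le> exp (2 * b * \<tau> - m / 2 * \<kappa>) * (\<Sum>S\<in>Pow J. W S)"
      using Z by (intro mult_left_mono) auto
    finally show "exp (?s (real d / m) - b * (real d / m)\<^sup>2 * m / 2)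
        \<le> exp (2 * b * \<tau> - m / 2 * \<kappa>) * (\<Sum>S\<in>Pow J. W S)" by (simp only: q_def)
  qed
  finally show ?thesis by simp
qed

definition attach_star :: "nat \<Rightarrow> nat set \<Rightarrow> (nat \<Rightarrow> nat \<Rightarrow> nat) \<Rightarrow> nat \<Rightarrow> nat \<Rightarrow> nat" where
  "attach_star i S y = (\<lambda>a b. if a = i then of_bool (b \<in> S) else if b = i then of_bool (a \<in> S) else y a b)"

definition isolated_graphs :: "nat \<Rightarrow> nat \<Rightarrow> (nat \<Rightarrow> nat \<Rightarrow> nat) set" where
  "isolated_graphs n i = {y \<in> simple_graphs n. \<forall>j. y i j = 0}"

lemma attach_star_in_simple_graphs:
  assumes "y \<in> isolated_graphs n i" "i \<in> {1..n}" "S \<subseteq> {1..n} - {i}"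
  shows "attach_star i S y \<in> simple_graphs n"
proof -
  have y: "y \<in> simple_graphs n" using assms(1) by (simp add: isolated_graphs_def)
  note D = simple_graphsD[OF y]
  have "attach_star i S y a b \<in> {0, 1}" for a b
    using D(1)[of a b] by (auto simp: attach_star_def)
  moreover have "attach_star i S y a b = attach_star i S y b a" for a b
    using D(2)[of a b] by (auto simp: attach_star_def)
  moreover have "attach_star i S y a a = 0" for a
    using D(3)[of a] assms(3) by (auto simp: attach_star_def)
  moreover have "attach_star i S y a b = 0" if "a \<notin> {1..n} \<or> b \<notin> {1..n}" for a b
    using D(4)[OF that] assms(2,3) that by (auto simp: attach_star_def)
  ultimately show ?thesis unfolding simple_graphs_def by blast
qed

text \<open>
  A graph is the same as its restriction to the vertices other than \<open>i\<close> together with the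
  neighbourhood of \<open>i\<close>. This plays the role of conditioning on the edges away from \<open>i\<close>.
\<close>

lemma sum_graphs_attach_star:
  assumes i: "i \<in> {1..n}"
  shows "(\<Sum>x\<in>simple_graphs n. f x)
    = (\<Sum>y\<in>isolated_graphs n i. \<Sum>S\<in>Pow ({1..n} - {i}). f (attach_star i S y))"
proof -
  have "(\<Sum>x\<in>simple_graphs n. f x)
    = (\<Sum>(y, S)\<in>isolated_graphs n i \<times> Pow ({1..n} - {i}). f (attach_star i S y))"
  proof (rule sum.reindex_bij_witness [where i = "\<lambda>(y, S). attach_star i S y" and
        j = "\<lambda>x. (\<lambda>a b. if a = i \<or> b = i then 0 else x a b, {j. x i j = 1})"])
    fix x assume x: "x \<in> simple_graphs n"
    note D = simple_graphsD[OF x]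
    have inv: "attach_star i {j. x i j = 1} (\<lambda>a b. if a = i \<or> b = i then 0 else x a b) = x"
    proof (intro ext)
      fix a b
      show "attach_star i {j. x i j = 1} (\<lambda>a b. if a = i \<or> b = i then 0 else x a b) a b = x a b"
        using D(1)[of i a] D(1)[of i b] D(2)[of a i] by (auto simp: attach_star_def)
    qed
    then show "(case (\<lambda>a b. if a = i \<or> b = i then 0 else x a b, {j. x i j = 1}) of
        (y, S) \<Rightarrow> attach_star i S y) = x" by simp
    have "(\<lambda>a b. if a = i \<or> b = i then 0 else x a b) \<in> isolated_graphs n i"
      using x by (auto simp: isolated_graphs_def simple_graphs_def)
    moreover have "{j. x i j = 1} \<subseteq> {1..n} - {i}"
    proof
      fix j assume "j \<in> {j. x i j = 1}"
      then show "j \<in> {1..n} - {i}" using D(3)[of i] D(4)[of i j] by fastforce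
    qed
    ultimately show "(\<lambda>a b. if a = i \<or> b = i then 0 else x a b, {j. x i j = 1})
        \<in> isolated_graphs n i \<times> Pow ({1..n} - {i})" by blast
    show "(case (\<lambda>a b. if a = i \<or> b = i then 0 else x a b, {j. x i j = 1}) of
        (y, S) \<Rightarrow> f (attach_star i S y)) = f x" using inv by simp
  next
    fix z assume z: "z \<in> isolated_graphs n i \<times> Pow ({1..n} - {i})"
    then obtain y S where yS: "z = (y, S)" "y \<in> isolated_graphs n i" "S \<subseteq> {1..n} - {i}" by auto
    then have y: "y \<in> simple_graphs n" "\<And>j. y i j = 0" by (auto simp: isolated_graphs_def)
    show "(case z of (y, S) \<Rightarrow> attach_star i S y) \<in> simple_graphs n"
      using attach_star_in_simple_graphs[OF yS(2) i yS(3)] yS(1) by simp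
    have "(\<lambda>a b. if a = i \<or> b = i then 0 else attach_star i S y a b) = y"
      using y(2) simple_graphsD(2)[OF y(1), of _ i] by (intro ext) (auto simp: attach_star_def)
    moreover have "{j. attach_star i S y i j = 1} = S" by (auto simp: attach_star_def)
    ultimately show "(\<lambda>a b. if a = i \<or> b = i then 0 else (case z of (y, S) \<Rightarrow> attach_star i S y) a b,
        {j. (case z of (y, S) \<Rightarrow> attach_star i S y) i j = 1}) = z"
      unfolding yS(1) prod.case by simp
  qed
  then show ?thesis by (simp add: sum.cartesian_product)
qed

lemma vertex_degree_attach_star:
  assumes y: "y \<in> isolated_graphs n i" and i: "i \<in> {1..n}" and S: "S \<subseteq> {1..n} - {i}"
  shows "vertex_degree n (attach_star i S y) i = card S"
    and "j \<in> {1..n} - {i} \<Longrightarrow>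
      vertex_degree n (attach_star i S y) j = vertex_degree n y j + of_bool (j \<in> S)"
proof -
  have "vertex_degree n (attach_star i S y) i = (\<Sum>j\<in>{1..n} - {i}. of_bool (j \<in> S))"
    by (simp add: vertex_degree_def attach_star_def)
  also have "\<dots> = (\<Sum>j\<in>S. 1)"
    using S by (intro sum.mono_neutral_cong_right) auto
  finally show "vertex_degree n (attach_star i S y) i = card S" by simp
next
  assume j: "j \<in> {1..n} - {i}"
  have y': "y \<in> simple_graphs n" "y i j = 0" using y by (auto simp: isolated_graphs_def)
  then have yji: "y j i = 0" using simple_graphsD(2)[OF y'(1), of i j] by simp
  have split: "vertex_degree n z j = z j i + (\<Sum>l\<in>{1..n} - {j} - {i}. z j l)" for z
    unfolding vertex_degree_def using i j by (intro sum.remove) auto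
  have "(\<Sum>l\<in>{1..n} - {j} - {i}. attach_star i S y j l) = (\<Sum>l\<in>{1..n} - {j} - {i}. y j l)"
    using j by (intro sum.cong) (auto simp: attach_star_def)
  then show "vertex_degree n (attach_star i S y) j = vertex_degree n y j + of_bool (j \<in> S)"
    unfolding split using j yji by (simp add: attach_star_def)
qed

text \<open>
  Connecting \<open>j\<close> to \<open>i\<close> raises the square of its degree \<open>k\<close> by \<open>2 k + 1\<close>; hence the shift by one half in
  the field that \<open>j\<close> exerts on the new edge.
\<close>

lemma two_star_weight_attach_star:
  assumes y: "y \<in> isolated_graphs n i" and i: "i \<in> {1..n}" and S: "S \<subseteq> {1..n} - {i}"
  defines "m \<equiv> real n - 1"
  shows "two_star_weight n \<beta>\<^sub>1 \<beta>\<^sub>2 (attach_star i S y) = two_star_weight n \<beta>\<^sub>1 \<beta>\<^sub>2 y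
    * exp (\<beta>\<^sub>2 / (2 * m) * (real (card S))\<^sup>2
           + (\<Sum>j\<in>S. \<beta>\<^sub>1 + \<beta>\<^sub>2 * ((real (vertex_degree n y j) + 1 / 2) / m)))"
proof -
  let ?J = "{1..n} - {i}"
  let ?x = "attach_star i S y"
  let ?k = "\<lambda>j. real (vertex_degree n y j)"
  have y': "y \<in> simple_graphs n" "\<And>j. y i j = 0" using y by (auto simp: isolated_graphs_def)
  have x: "?x \<in> simple_graphs n" by (rule attach_star_in_simple_graphs[OF y i S])
  have ki: "?k i = 0" by (simp add: vertex_degree_def y'(2))
  have split: "(\<Sum>j\<in>{1..n}. g j) = g i + (\<Sum>j\<in>?J. g j)" for g :: "nat \<Rightarrow> real"
    using i by (intro sum.remove) auto
  have deg: "real (vertex_degree n ?x j) = ?k j + of_bool (j \<in> S)" if "j \<in> ?J" for j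
    using vertex_degree_attach_star(2)[OF y i S that] by simp
  have deg_i: "real (vertex_degree n ?x i) = real (card S)"
    using vertex_degree_attach_star(1)[OF y i S] by simp
  have restr: "(\<Sum>j\<in>?J. of_bool (j \<in> S) * g j) = (\<Sum>j\<in>S. g j)" for g :: "nat \<Rightarrow> real"
    using S by (intro sum.mono_neutral_cong_right) auto
  have D1: "(\<Sum>j\<in>{1..n}. real (vertex_degree n ?x j)) = (\<Sum>j\<in>{1..n}. ?k j) + 2 * real (card S)"
  proof -
    have "(\<Sum>j\<in>?J. real (vertex_degree n ?x j)) = (\<Sum>j\<in>?J. ?k j + of_bool (j \<in> S) * 1)"
      by (intro sum.cong refl) (simp add: deg)
    also have "\<dots> = (\<Sum>j\<in>?J. ?k j) + real (card S)"
      unfolding sum.distrib restr by simp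
    finally show ?thesis unfolding split by (simp add: deg_i ki)
  qed
  have D2: "(\<Sum>j\<in>{1..n}. (real (vertex_degree n ?x j))\<^sup>2)
      = (\<Sum>j\<in>{1..n}. (?k j)\<^sup>2) + (real (card S))\<^sup>2 + (\<Sum>j\<in>S. 2 * ?k j + 1)"
  proof -
    have "(\<Sum>j\<in>?J. (real (vertex_degree n ?x j))\<^sup>2) = (\<Sum>j\<in>?J. (?k j)\<^sup>2 + of_bool (j \<in> S) * (2 * ?k j + 1))"
      by (intro sum.cong refl) (auto simp: deg power2_eq_square algebra_simps)
    also have "\<dots> = (\<Sum>j\<in>?J. (?k j)\<^sup>2) + (\<Sum>j\<in>S. 2 * ?k j + 1)"
      unfolding sum.distrib restr by simp
    finally show ?thesis unfolding split by (simp add: deg_i ki)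
  qed
  have "(\<Sum>j\<in>S. \<beta>\<^sub>1 + \<beta>\<^sub>2 * ((?k j + 1 / 2) / m)) = \<beta>\<^sub>1 * real (card S) + \<beta>\<^sub>2 / (2 * m) * (\<Sum>j\<in>S. 2 * ?k j + 1)"
  proof -
    have "\<beta>\<^sub>1 + \<beta>\<^sub>2 * ((?k j + 1 / 2) / m) = \<beta>\<^sub>1 + \<beta>\<^sub>2 / (2 * m) * (2 * ?k j + 1)" for j
      by (cases "m = 0") (simp_all add: field_simps)
    then have "(\<Sum>j\<in>S. \<beta>\<^sub>1 + \<beta>\<^sub>2 * ((?k j + 1 / 2) / m))
        = (\<Sum>j\<in>S. \<beta>\<^sub>1 + \<beta>\<^sub>2 / (2 * m) * (2 * ?k j + 1))" by (intro sum.cong refl)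
    also have "\<dots> = (\<Sum>j\<in>S. \<beta>\<^sub>1) + \<beta>\<^sub>2 / (2 * m) * (\<Sum>j\<in>S. 2 * ?k j + 1)"
      by (simp only: sum.distrib [of "\<lambda>_. \<beta>\<^sub>1"] sum_distrib_left)
    finally show ?thesis by simp
  qed
  then show ?thesis
    unfolding two_star_weight_eq[OF x] two_star_weight_eq[OF y'(1)] D1 D2 m_def
    by (simp add: exp_add [symmetric] distrib_left)
qed

text \<open>
  Summation over the star of \<open>i\<close> is done separately for each graph \<open>y\<close> on the other vertices. Either no
  star on \<open>y\<close> makes the total deviation of the degrees at most \<open>\<tau>\<close>, and then \<open>y\<close> contributes nothing;
  or one star does, and then the degrees in \<open>y\<close>, which change by at most 1 when a star is attached,
  are on average so close to \<open>p\<^sub>0\<close> that \<open>star_degree_deviation\<close> applies to all stars on \<open>y\<close>. The extra \<open>1 / 2\<close> is the sum over \<open>j\<close> of the discrepancy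
  \<open>1 / (2 m)\<close> between \<open>(k + 1 / 2) / m\<close> and either of the possible values \<open>k / m\<close> and \<open>(k + 1) / m\<close>.
\<close>

lemma single_vertex_deviation:
  assumes n: "n \<ge> 2" and i: "i \<in> {1..n}" and \<beta>\<^sub>2: "\<beta>\<^sub>2 \<ge> 0"
    and far: "\<And>p. p \<in> {0..1} \<Longrightarrow> \<delta> < \<bar>p - p\<^sub>0\<bar> \<Longrightarrow> \<kappa> \<le> mean_field \<beta>\<^sub>1 \<beta>\<^sub>2 p\<^sub>0 - mean_field \<beta>\<^sub>1 \<beta>\<^sub>2 p"
  defines "m \<equiv> real n - 1"
  shows "(\<Sum>x\<in>{x \<in> simple_graphs n. \<delta> < \<bar>real (vertex_degree n x i) / m - p\<^sub>0\<bar> \<and>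
              (\<Sum>j\<in>{1..n}. \<bar>real (vertex_degree n x j) / m - p\<^sub>0\<bar>) \<le> \<tau>}. two_star_weight n \<beta>\<^sub>1 \<beta>\<^sub>2 x)
     \<le> real n * exp (2 * \<beta>\<^sub>2 * (\<tau> + 1 / 2) - m / 2 * \<kappa>) * two_star_Z n \<beta>\<^sub>1 \<beta>\<^sub>2"
proof -
  define J where "J = {1..n} - {i}"
  have m: "m > 0" using n by (simp add: m_def)
  have J: "finite J" "m = real (card J)" using n i by (auto simp: J_def m_def of_nat_diff)
  let ?w = "two_star_weight n \<beta>\<^sub>1 \<beta>\<^sub>2"
  let ?bad = "\<lambda>x. \<delta> < \<bar>real (vertex_degree n x i) / m - p\<^sub>0\<bar>"
  let ?near = "\<lambda>x. (\<Sum>j\<in>{1..n}. \<bar>real (vertex_degree n x j) / m - p\<^sub>0\<bar>) \<le> \<tau>"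
  let ?K = "real n * exp (2 * \<beta>\<^sub>2 * (\<tau> + 1 / 2) - m / 2 * \<kappa>)"
  have w_pos: "0 \<le> ?w x" for x by (simp add: two_star_weight_def)
  have star: "(\<Sum>S\<in>Pow J. if ?bad (attach_star i S y) \<and> ?near (attach_star i S y) then ?w (attach_star i S y) else 0)
      \<le> ?K * (\<Sum>S\<in>Pow J. ?w (attach_star i S y))" if y: "y \<in> isolated_graphs n i" for y
  proof (cases "\<exists>S\<in>Pow J. ?near (attach_star i S y)")
    case False
    then have "(\<Sum>S\<in>Pow J. if ?bad (attach_star i S y) \<and> ?near (attach_star i S y) then ?w (attach_star i S y) else 0) = 0"
      by (intro sum.neutral) auto
    also have "0 \<le> ?K * (\<Sum>S\<in>Pow J. ?w (attach_star i S y))"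
      by (intro mult_nonneg_nonneg sum_nonneg w_pos) auto
    finally show ?thesis .
  next
    case True
    define t where "t j = (real (vertex_degree n y j) + 1 / 2) / m" for j
    define W where "W S = exp (\<beta>\<^sub>2 / (2 * m) * (real (card S))\<^sup>2 + (\<Sum>j\<in>S. \<beta>\<^sub>1 + \<beta>\<^sub>2 * t j))" for S
    define D where "D = {d \<in> {0..n - 1}. \<delta> < \<bar>real d / m - p\<^sub>0\<bar>}"
    have w: "?w (attach_star i S y) = ?w y * W S" if "S \<in> Pow J" for S
      using two_star_weight_attach_star[OF y i, of S] that by (simp add: W_def t_def m_def J_def)
    from True obtain R where R: "R \<subseteq> J" "?near (attach_star i R y)" by auto
    have close: "(\<Sum>j\<in>J. \<bar>t j - p\<^sub>0\<bar>) \<le> \<tau> + 1 / 2"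
    proof -
      have "(\<Sum>j\<in>J. \<bar>t j - p\<^sub>0\<bar>)
          \<le> (\<Sum>j\<in>J. \<bar>real (vertex_degree n (attach_star i R y) j) / m - p\<^sub>0\<bar> + 1 / (2 * m))"
      proof (rule sum_mono)
        fix j assume j: "j \<in> J"
        have "real (vertex_degree n (attach_star i R y) j) / m
            = (real (vertex_degree n y j) + of_bool (j \<in> R)) / m"
          using vertex_degree_attach_star(2)[OF y i, of R j] R(1) j by (simp add: J_def)
        also have "\<dots> = t j + (of_bool (j \<in> R) - 1 / 2) / m"
          by (simp add: t_def add_divide_distrib diff_divide_distrib)
        finally have "real (vertex_degree n (attach_star i R y) j) / m - t j = (of_bool (j \<in> R) - 1 / 2) / m"
          by linarith
        then have "\<bar>real (vertex_degree n (attach_star i R y) j) / m - t j\<bar> \<le> 1 / (2 * m)"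
          using m by (cases "j \<in> R") simp_all
        then show "\<bar>t j - p\<^sub>0\<bar> \<le> \<bar>real (vertex_degree n (attach_star i R y) j) / m - p\<^sub>0\<bar> + 1 / (2 * m)"
          by linarith
      qed
      also have "\<dots> = (\<Sum>j\<in>J. \<bar>real (vertex_degree n (attach_star i R y) j) / m - p\<^sub>0\<bar>) + 1 / 2"
        using m by (simp add: sum.distrib J(2) [symmetric])
      also have "(\<Sum>j\<in>J. \<bar>real (vertex_degree n (attach_star i R y) j) / m - p\<^sub>0\<bar>)
          \<le> (\<Sum>j\<in>{1..n}. \<bar>real (vertex_degree n (attach_star i R y) j) / m - p\<^sub>0\<bar>)"
        by (rule sum_mono2) (auto simp: J_def)
      finally show ?thesis using R(2) by linarith
    qed
    have finD: "finite D" by (simp add: D_def)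
    have cardD: "card D \<le> n"
    proof -
      have "card D \<le> card {0..n - 1}" unfolding D_def by (rule card_mono) auto
      then show ?thesis using n by simp
    qed
    have farD: "\<kappa> \<le> mean_field \<beta>\<^sub>1 \<beta>\<^sub>2 p\<^sub>0 - mean_field \<beta>\<^sub>1 \<beta>\<^sub>2 (real d / m)" if "d \<in> D" for d
    proof (rule far)
      have "real d \<le> m" using that n by (auto simp: D_def m_def)
      then show "real d / m \<in> {0..1}" using m by simp
      show "\<delta> < \<bar>real d / m - p\<^sub>0\<bar>" using that by (simp add: D_def)
    qed
    have "(\<Sum>S\<in>Pow J. if ?bad (attach_star i S y) \<and> ?near (attach_star i S y) then ?w (attach_star i S y) else 0)
        \<le> (\<Sum>S\<in>Pow J. if card S \<in> D then ?w y * W S else 0)"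
    proof (rule sum_mono)
      fix S assume S: "S \<in> Pow J"
      have "card S \<le> n - 1" using card_mono[OF J(1), of S] S n i by (auto simp: J_def)
      moreover have "vertex_degree n (attach_star i S y) i = card S"
        using vertex_degree_attach_star(1)[OF y i] S by (simp add: J_def)
      moreover have "0 \<le> ?w y * W S" using w_pos by (simp add: W_def)
      ultimately show "(if ?bad (attach_star i S y) \<and> ?near (attach_star i S y) then ?w (attach_star i S y) else 0)
        \<le> (if card S \<in> D then ?w y * W S else 0)"
        using w[OF S] by (auto simp: D_def)
    qed
    also have "\<dots> = ?w y * (\<Sum>S\<in>{S\<in>Pow J. card S \<in> D}. W S)"
      using J(1) by (simp add: sum.If_cases sum_distrib_left Int_def)
    also have "\<dots> \<le> ?w y * (real (card D) * exp (2 * \<beta>\<^sub>2 * (\<tau> + 1 / 2) - m / 2 * \<kappa>) * (\<Sum>S\<in>Pow J. W S))"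
      unfolding W_def
      by (intro mult_left_mono w_pos star_degree_deviation[OF J m \<beta>\<^sub>2 finD close farD])
    also have "\<dots> \<le> ?w y * (?K * (\<Sum>S\<in>Pow J. W S))"
      using cardD by (intro mult_left_mono mult_right_mono w_pos sum_nonneg) (auto simp: W_def)
    also have "\<dots> = ?K * (\<Sum>S\<in>Pow J. ?w (attach_star i S y))"
      by (simp add: w sum_distrib_left [symmetric])
    finally show ?thesis .
  qed
  have "(\<Sum>x\<in>{x \<in> simple_graphs n. ?bad x \<and> ?near x}. ?w x)
      = (\<Sum>x\<in>simple_graphs n. if ?bad x \<and> ?near x then ?w x else 0)"
    using finite_simple_graphs[of n] by (simp add: sum.If_cases Int_def)
  also have "\<dots> = (\<Sum>y\<in>isolated_graphs n i. \<Sum>S\<in>Pow J.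
      if ?bad (attach_star i S y) \<and> ?near (attach_star i S y) then ?w (attach_star i S y) else 0)"
    unfolding J_def by (rule sum_graphs_attach_star[OF i])
  also have "\<dots> \<le> (\<Sum>y\<in>isolated_graphs n i. ?K * (\<Sum>S\<in>Pow J. ?w (attach_star i S y)))"
    by (rule sum_mono[OF star])
  also have "\<dots> = ?K * two_star_Z n \<beta>\<^sub>1 \<beta>\<^sub>2"
    unfolding two_star_Z_def sum_graphs_attach_star[OF i] J_def sum_distrib_left ..
  finally show ?thesis .
qed

section \<open>Concentration of all degrees\<close>

lemma prob_two_star_le:
  assumes "(\<Sum>x\<in>{x \<in> simple_graphs n. P x}. two_star_weight n \<beta>\<^sub>1 \<beta>\<^sub>2 x) \<le> K * two_star_Z n \<beta>\<^sub>1 \<beta>\<^sub>2"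
  shows "measure_pmf.prob (two_star_pmf n \<beta>\<^sub>1 \<beta>\<^sub>2) {x. P x} \<le> K"
proof -
  let ?p = "two_star_pmf n \<beta>\<^sub>1 \<beta>\<^sub>2"
  have "set_pmf ?p \<subseteq> simple_graphs n"
    by (auto simp: set_pmf_iff pmf_two_star_pmf split: if_splits)
  then have eq: "{x. P x} \<inter> set_pmf ?p = {x \<in> simple_graphs n. P x} \<inter> set_pmf ?p" by auto
  have "measure_pmf.prob ?p {x. P x} = measure_pmf.prob ?p {x \<in> simple_graphs n. P x}"
    using eq measure_Int_set_pmf [of ?p "{x. P x}"] measure_Int_set_pmf [of ?p "{x \<in> simple_graphs n. P x}"]
    by simp
  also have "\<dots> = (\<Sum>x\<in>{x \<in> simple_graphs n. P x}. pmf ?p x)"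
    by (rule measure_measure_pmf_finite) (simp add: finite_simple_graphs)
  also have "\<dots> = (\<Sum>x\<in>{x \<in> simple_graphs n. P x}. two_star_weight n \<beta>\<^sub>1 \<beta>\<^sub>2 x) / two_star_Z n \<beta>\<^sub>1 \<beta>\<^sub>2"
    unfolding sum_divide_distrib by (intro sum.cong) (auto simp: pmf_two_star_pmf)
  also have "\<dots> \<le> K"
    using assms two_star_Z_pos[of n \<beta>\<^sub>1 \<beta>\<^sub>2] by (simp add: pos_divide_le_eq)
  finally show ?thesis .
qed

lemma Max_deviation_gt_iff:
  fixes f :: "nat \<Rightarrow> real"
  assumes "n \<ge> 1"
  shows "Max (f ` {1..n}) > \<delta> \<longleftrightarrow> (\<exists>i\<in>{1..n}. f i > \<delta>)"
  using assms by (subst Max_gr_iff) auto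

text \<open>
  Let \<open>\<kappa>\<close> be the gap of the mean-field functional at distance \<open>\<delta>\<close>. Graphs whose total deviation exceeds
  \<open>\<epsilon> n\<close> are handled by counting degree profiles, with probability \<open>K\<^sub>1 n = exp (- c n\<^sup>2 + O(n ln n))\<close>. On
  the rest, each vertex deviates by \<open>\<delta>\<close> with probability at most \<open>K\<^sub>2 n\<close>, and \<open>\<epsilon>\<close> is small enough that
  the error \<open>2 \<beta>\<^sub>2 \<epsilon> n\<close> does not consume the gain \<open>\<kappa> n / 2\<close>.
\<close>

lemma degree_concentration:
  assumes \<beta>\<^sub>2: "\<beta>\<^sub>2 > 0" and p\<^sub>0: "p\<^sub>0 \<in> {0..1}"
    and max: "\<And>p. p \<in> {0..1} \<Longrightarrow> p \<noteq> p\<^sub>0 \<Longrightarrow> mean_field \<beta>\<^sub>1 \<beta>\<^sub>2 p < mean_field \<beta>\<^sub>1 \<beta>\<^sub>2 p\<^sub>0"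
    and \<delta>: "\<delta> > 0"
  shows "\<exists>C>0. \<exists>N. \<forall>n\<ge>N. measure_pmf.prob (two_star_pmf n \<beta>\<^sub>1 \<beta>\<^sub>2)
      {x. Max ((\<lambda>i. \<bar>real (vertex_degree n x i) / (real n - 1) - p\<^sub>0\<bar>) ` {1..n}) > \<delta>} \<le> exp (- C * real n)"
proof -
  let ?G = "mean_field \<beta>\<^sub>1 \<beta>\<^sub>2"
  obtain \<eta> where \<eta>: "\<eta> > 0" "\<And>p. p \<in> {0..1} \<Longrightarrow> \<eta> * (\<bar>p - p\<^sub>0\<bar> - \<delta> / 2) \<le> ?G p\<^sub>0 - ?G p"
    using strict_maximum_gap[OF continuous_on_mean_field p\<^sub>0 max, of "\<delta> / 2"] \<delta> by auto
  define \<kappa> where "\<kappa> = \<eta> * \<delta> / 2"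
  have \<kappa>: "\<kappa> > 0" using \<eta>(1) \<delta> by (simp add: \<kappa>_def)
  have far: "\<kappa> \<le> ?G p\<^sub>0 - ?G p" if "p \<in> {0..1}" "\<delta> < \<bar>p - p\<^sub>0\<bar>" for p
  proof -
    have "\<kappa> = \<eta> * (\<delta> / 2)" by (simp add: \<kappa>_def)
    also have "\<dots> \<le> \<eta> * (\<bar>p - p\<^sub>0\<bar> - \<delta> / 2)" using \<eta>(1) that(2) by (intro mult_left_mono) auto
    finally show ?thesis using \<eta>(2)[OF that(1)] by linarith
  qed
  \<comment> \<open>With this choice \<open>2 \<beta>\<^sub>2 \<epsilon> = \<kappa> / 8\<close>, a quarter of the gain \<open>\<kappa> / 2\<close>.\<close>
  define \<epsilon> where "\<epsilon> = \<kappa> / (16 * \<beta>\<^sub>2)"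
  have \<epsilon>: "\<epsilon> > 0" using \<kappa> \<beta>\<^sub>2 by (simp add: \<epsilon>_def)
  obtain \<eta>' where \<eta>': "\<eta>' > 0" "\<And>p. p \<in> {0..1} \<Longrightarrow> \<eta>' * (\<bar>p - p\<^sub>0\<bar> - \<epsilon> / 2) \<le> ?G p\<^sub>0 - ?G p"
    using strict_maximum_gap[OF continuous_on_mean_field p\<^sub>0 max, of "\<epsilon> / 2"] \<epsilon> by auto
  define c where "c = \<eta>' * \<epsilon> / 4"
  have c: "c > 0" using \<eta>'(1) \<epsilon> by (simp add: c_def)
  define K\<^sub>1 where "K\<^sub>1 n = real (n ^ n) * exp (- (real n - 1) / 2 * (2 * c * real n))" for n
  define K\<^sub>2 where "K\<^sub>2 n = real n * exp (2 * \<beta>\<^sub>2 * (\<epsilon> * real n + 1 / 2) - (real n - 1) / 2 * \<kappa>)" for n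
  have bound: "measure_pmf.prob (two_star_pmf n \<beta>\<^sub>1 \<beta>\<^sub>2)
      {x. Max ((\<lambda>i. \<bar>real (vertex_degree n x i) / (real n - 1) - p\<^sub>0\<bar>) ` {1..n}) > \<delta>}
      \<le> K\<^sub>1 n + real n * K\<^sub>2 n" if n: "n \<ge> 2" for n
  proof -
    let ?p = "\<lambda>x i. real (vertex_degree n x i) / (real n - 1)"
    let ?P = "measure_pmf.prob (two_star_pmf n \<beta>\<^sub>1 \<beta>\<^sub>2)"
    let ?A = "{x. \<epsilon> * real n < (\<Sum>i\<in>{1..n}. \<bar>?p x i - p\<^sub>0\<bar>)}"
    let ?B = "\<lambda>i. {x. \<delta> < \<bar>?p x i - p\<^sub>0\<bar> \<and> (\<Sum>j\<in>{1..n}. \<bar>?p x j - p\<^sub>0\<bar>) \<le> \<epsilon> * real n}"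
    have A: "?P ?A \<le> K\<^sub>1 n"
    proof (rule prob_two_star_le)
      show "(\<Sum>x\<in>{x \<in> simple_graphs n. \<epsilon> * real n < (\<Sum>i\<in>{1..n}. \<bar>?p x i - p\<^sub>0\<bar>)}. two_star_weight n \<beta>\<^sub>1 \<beta>\<^sub>2 x)
        \<le> K\<^sub>1 n * two_star_Z n \<beta>\<^sub>1 \<beta>\<^sub>2"
        unfolding K\<^sub>1_def
      proof (rule weight_of_degree_profiles_le[OF n, where P = "\<lambda>p. \<epsilon> * real n < (\<Sum>i\<in>{1..n}. \<bar>p i - p\<^sub>0\<bar>)"])
        show "0 \<le> \<beta>\<^sub>2" using \<beta>\<^sub>2 by simp
      next
        fix p :: "nat \<Rightarrow> real"
        assume p: "\<And>i. i \<in> {1..n} \<Longrightarrow> p i \<in> {0..1}" and dev: "\<epsilon> * real n < (\<Sum>i\<in>{1..n}. \<bar>p i - p\<^sub>0\<bar>)"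
        have "2 * c * real n = \<eta>' * (\<epsilon> * real n - real n * (\<epsilon> / 2))"
          by (simp add: c_def algebra_simps)
        also have "\<dots> \<le> \<eta>' * ((\<Sum>i\<in>{1..n}. \<bar>p i - p\<^sub>0\<bar>) - real n * (\<epsilon> / 2))"
          using dev \<eta>'(1) by (intro mult_left_mono) auto
        also have "\<dots> = (\<Sum>i\<in>{1..n}. \<eta>' * (\<bar>p i - p\<^sub>0\<bar> - \<epsilon> / 2))"
          by (simp add: sum_distrib_left [symmetric] sum_subtractf)
        also have "\<dots> \<le> (\<Sum>i\<in>{1..n}. ?G p\<^sub>0 - ?G (p i))"
          by (intro sum_mono \<eta>'(2) p)
        finally show "2 * c * real n \<le> (\<Sum>i\<in>{1..n}. ?G p\<^sub>0 - ?G (p i))" .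
      next
        fix p p' :: "nat \<Rightarrow> real"
        assume "\<And>i. i \<in> {1..n} \<Longrightarrow> p i = p' i" "\<epsilon> * real n < (\<Sum>i\<in>{1..n}. \<bar>p i - p\<^sub>0\<bar>)"
        then show "\<epsilon> * real n < (\<Sum>i\<in>{1..n}. \<bar>p' i - p\<^sub>0\<bar>)" by simp
      qed
    qed
    have B: "?P (?B i) \<le> K\<^sub>2 n" if i: "i \<in> {1..n}" for i
      unfolding K\<^sub>2_def
      by (intro prob_two_star_le single_vertex_deviation[OF n i]) (use \<beta>\<^sub>2 far in auto)
    have "{x. Max ((\<lambda>i. \<bar>?p x i - p\<^sub>0\<bar>) ` {1..n}) > \<delta>} \<subseteq> ?A \<union> (\<Union>i\<in>{1..n}. ?B i)"
    proof
      fix x assume "x \<in> {x. Max ((\<lambda>i. \<bar>?p x i - p\<^sub>0\<bar>) ` {1..n}) > \<delta>}"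
      then obtain i where "i \<in> {1..n}" "\<delta> < \<bar>?p x i - p\<^sub>0\<bar>"
        using Max_deviation_gt_iff[of n \<delta> "\<lambda>i. \<bar>?p x i - p\<^sub>0\<bar>"] n by auto
      then show "x \<in> ?A \<union> (\<Union>i\<in>{1..n}. ?B i)" by (cases "x \<in> ?A") auto
    qed
    then have "?P {x. Max ((\<lambda>i. \<bar>?p x i - p\<^sub>0\<bar>) ` {1..n}) > \<delta>} \<le> ?P (?A \<union> (\<Union>i\<in>{1..n}. ?B i))"
      by (intro measure_pmf.finite_measure_mono) auto
    also have "\<dots> \<le> ?P ?A + ?P (\<Union>i\<in>{1..n}. ?B i)"
      by (rule measure_Un_le) auto
    also have "?P (\<Union>i\<in>{1..n}. ?B i) \<le> (\<Sum>i\<in>{1..n}. ?P (?B i))"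
      by (rule measure_pmf.finite_measure_subadditive_finite) auto
    also have "\<dots> \<le> (\<Sum>i\<in>{1..n}. K\<^sub>2 n)" by (rule sum_mono[OF B])
    finally show ?thesis using A by simp
  qed
  have "eventually (\<lambda>n. K\<^sub>1 n \<le> exp (- (\<kappa> / 8) * real n) / 2) at_top"
  proof -
    have "filterlim (\<lambda>n::nat. real n * (ln (real n) - c * (real n - 1) + \<kappa> / 8)) at_bot at_top"
      using c by real_asymp
    then have "eventually (\<lambda>n::nat. real n * (ln (real n) - c * (real n - 1) + \<kappa> / 8) \<le> - ln 2) at_top"
      by (simp add: filterlim_at_bot)
    then show ?thesis using eventually_ge_at_top[of 1]
    proof eventually_elim
      case (elim n)
      have "real (n ^ n) = exp (real n * ln (real n))"
        using elim(2) by (simp add: exp_of_nat_mult)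
      then have "K\<^sub>1 n = exp (real n * ln (real n) + - (real n - 1) / 2 * (2 * c * real n))"
        by (simp only: K\<^sub>1_def exp_add)
      also have "real n * ln (real n) + - (real n - 1) / 2 * (2 * c * real n)
          = real n * (ln (real n) - c * (real n - 1) + \<kappa> / 8) - \<kappa> / 8 * real n"
      proof -
        have "- a / 2 * (2 * c * real n) = - (real n * (c * a))" for a :: real by simp
        then show ?thesis by (simp only: distrib_left right_diff_distrib mult.commute [of "\<kappa> / 8"])
      qed
      also have "exp \<dots> \<le> exp (- ln 2 - \<kappa> / 8 * real n)" using elim(1) by simp
      also have "\<dots> = exp (- ln 2) * exp (- (\<kappa> / 8) * real n)"
        by (simp add: exp_add [symmetric])
      also have "\<dots> = exp (- (\<kappa> / 8) * real n) / 2"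
        by (simp add: exp_minus)
      finally show ?case .
    qed
  qed
  moreover have "eventually (\<lambda>n. real n * K\<^sub>2 n \<le> exp (- (\<kappa> / 8) * real n) / 2) at_top"
  proof -
    have "((\<lambda>n::nat. (real n)\<^sup>2 * exp (\<beta>\<^sub>2 + \<kappa> / 2) * exp (- (\<kappa> / 4) * real n)) \<longlongrightarrow> 0) at_top"
      using \<kappa> by real_asymp
    then have "eventually (\<lambda>n::nat. (real n)\<^sup>2 * exp (\<beta>\<^sub>2 + \<kappa> / 2) * exp (- (\<kappa> / 4) * real n) < 1 / 2) at_top"
      by (rule order_tendstoD) simp
    then show ?thesis
    proof eventually_elim
      case (elim n)
      have "2 * \<beta>\<^sub>2 * \<epsilon> = \<kappa> / 8" using \<beta>\<^sub>2 by (simp add: \<epsilon>_def)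
      then have "2 * \<beta>\<^sub>2 * (\<epsilon> * real n + 1 / 2) = \<kappa> / 8 * real n + \<beta>\<^sub>2"
        by (simp add: distrib_left flip: mult.assoc)
      moreover have "(real n - 1) / 2 * \<kappa> = \<kappa> / 2 * real n - \<kappa> / 2"
        by (simp add: left_diff_distrib diff_divide_distrib)
      ultimately have "2 * \<beta>\<^sub>2 * (\<epsilon> * real n + 1 / 2) - (real n - 1) / 2 * \<kappa>
          = (\<beta>\<^sub>2 + \<kappa> / 2) + - (\<kappa> / 4) * real n + - (\<kappa> / 8) * real n"
        by linarith
      then have "real n * K\<^sub>2 n
          = (real n)\<^sup>2 * exp (\<beta>\<^sub>2 + \<kappa> / 2) * exp (- (\<kappa> / 4) * real n) * exp (- (\<kappa> / 8) * real n)"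
        by (simp only: K\<^sub>2_def exp_add power2_eq_square mult.assoc)
      also have "\<dots> \<le> 1 / 2 * exp (- (\<kappa> / 8) * real n)"
        using elim by (intro mult_right_mono) auto
      finally show ?case by simp
    qed
  qed
  ultimately have "eventually (\<lambda>n. measure_pmf.prob (two_star_pmf n \<beta>\<^sub>1 \<beta>\<^sub>2)
      {x. Max ((\<lambda>i. \<bar>real (vertex_degree n x i) / (real n - 1) - p\<^sub>0\<bar>) ` {1..n}) > \<delta>} \<le> exp (- (\<kappa> / 8) * real n)) at_top"
    using eventually_ge_at_top[of 2]
  proof eventually_elim
    case (elim n)
    then show ?case using bound[OF elim(3)] by linarith
  qed
  then show ?thesis using \<kappa> by (intro exI[of _ "\<kappa> / 8"]) (simp add: eventually_at_top_linorder)
qed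

text \<open>
  If \<open>p \<noteq> q\<close>, no number is within \<open>\<bar>p - q\<bar> / 3\<close> of both, so already the value at vertex 1 puts every
  outcome into one of two events whose probabilities tend to 0.
\<close>

lemma degree_limit_unique:
  assumes conc: "\<And>p' \<delta>. p' \<in> {p, q} \<Longrightarrow> \<delta> > 0 \<Longrightarrow> \<exists>C>0. \<exists>N. \<forall>n\<ge>N.
      measure_pmf.prob (\<mu> n) {x. Max ((\<lambda>i. \<bar>f n x i - p'\<bar>) ` {1..n}) > \<delta>} \<le> exp (- C * real n)"
  shows "p = (q::real)"
proof (rule ccontr)
  assume "p \<noteq> q"
  define \<delta> where "\<delta> = \<bar>p - q\<bar> / 3"
  have \<delta>: "\<delta> > 0" using \<open>p \<noteq> q\<close> by (simp add: \<delta>_def)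
  let ?E = "\<lambda>n p'. {x. Max ((\<lambda>i. \<bar>f n x i - p'\<bar>) ` {1..n}) > \<delta>}"
  have small: "eventually (\<lambda>n. measure_pmf.prob (\<mu> n) (?E n p') < 1 / 2) at_top" if p': "p' \<in> {p, q}" for p'
  proof -
    obtain C N where C: "C > 0" and N: "\<And>n. n \<ge> N \<Longrightarrow> measure_pmf.prob (\<mu> n) (?E n p') \<le> exp (- C * real n)"
      using conc[OF p' \<delta>] by blast
    have "((\<lambda>n. exp (- C * real n)) \<longlongrightarrow> 0) at_top" using C by real_asymp
    then have "eventually (\<lambda>n. exp (- C * real n) < 1 / 2) at_top"
      by (rule order_tendstoD) simp
    then show ?thesis using eventually_ge_at_top[of N]
      by eventually_elim (use N in force)
  qed
  have "eventually (\<lambda>n::nat. False) at_top"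
    using small[OF insertI1] small[OF insertI2[OF singletonI]] eventually_ge_at_top[of 1]
  proof eventually_elim
    case (elim n)
    have "UNIV \<subseteq> ?E n p \<union> ?E n q"
    proof
      fix x
      have "\<bar>f n x 1 - p\<bar> > \<delta> \<or> \<bar>f n x 1 - q\<bar> > \<delta>" using \<delta> unfolding \<delta>_def by argo
      then show "x \<in> ?E n p \<union> ?E n q"
        using elim(3) Max_deviation_gt_iff[of n \<delta> "\<lambda>i. \<bar>f n x i - p\<bar>"] Max_deviation_gt_iff[of n \<delta> "\<lambda>i. \<bar>f n x i - q\<bar>"]
        by force
    qed
    then have "?E n p \<union> ?E n q = UNIV" by blast
    then have "1 = measure_pmf.prob (\<mu> n) (?E n p \<union> ?E n q)" by (metis measure_pmf_UNIV)
    also have "\<dots> \<le> measure_pmf.prob (\<mu> n) (?E n p) + measure_pmf.prob (\<mu> n) (?E n q)"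
      by (rule measure_Un_le) auto
    finally show False using elim(1,2) by simp
  qed
  then show False by simp
qed

theorem theorem4p2:
  fixes \<beta>\<^sub>1 \<beta>\<^sub>2 \<theta>\<^sub>1 \<theta>\<^sub>2 :: real
  assumes "\<beta>\<^sub>2 > 0"
    and "\<theta>\<^sub>2 = \<beta>\<^sub>2 / 4"
    and "\<theta>\<^sub>1 = (\<beta>\<^sub>1 + \<beta>\<^sub>2) / 2"
    and "(\<theta>\<^sub>1, \<theta>\<^sub>2) \<in> Theta1"
  shows "\<exists>!p\<^sub>0::real. p\<^sub>0 \<in> {0<..<1} \<and>
    (\<forall>\<delta>>0. \<exists>C>0. \<exists>N. \<forall>n\<ge>N.
      measure_pmf.prob (two_star_pmf n \<beta>\<^sub>1 \<beta>\<^sub>2)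
        {x. Max ((\<lambda>i. \<bar>real (vertex_degree n x i) / (real n - 1) - p\<^sub>0\<bar>) ` {1..n}) > \<delta>}
      \<le> exp (- C * real n))"
proof -
  obtain p\<^sub>0 where p\<^sub>0: "p\<^sub>0 \<in> {0<..<1}"
    "\<And>p. p \<in> {0..1} \<Longrightarrow> p \<noteq> p\<^sub>0 \<Longrightarrow> mean_field \<beta>\<^sub>1 \<beta>\<^sub>2 p < mean_field \<beta>\<^sub>1 \<beta>\<^sub>2 p\<^sub>0"
    using mean_field_maximizer assms(2-4) by blast
  have mem: "p\<^sub>0 \<in> {0..1}" using p\<^sub>0(1) by auto
  show ?thesis
  proof (rule ex1I[of _ p\<^sub>0])
    show "p\<^sub>0 \<in> {0<..<1} \<and> (\<forall>\<delta>>0. \<exists>C>0. \<exists>N. \<forall>n\<ge>N.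
      measure_pmf.prob (two_star_pmf n \<beta>\<^sub>1 \<beta>\<^sub>2)
        {x. Max ((\<lambda>i. \<bar>real (vertex_degree n x i) / (real n - 1) - p\<^sub>0\<bar>) ` {1..n}) > \<delta>}
      \<le> exp (- C * real n))"
      using p\<^sub>0(1) degree_concentration[OF assms(1) mem p\<^sub>0(2)] by blast
    fix q assume q: "q \<in> {0<..<1} \<and> (\<forall>\<delta>>0. \<exists>C>0. \<exists>N. \<forall>n\<ge>N.
      measure_pmf.prob (two_star_pmf n \<beta>\<^sub>1 \<beta>\<^sub>2)
        {x. Max ((\<lambda>i. \<bar>real (vertex_degree n x i) / (real n - 1) - q\<bar>) ` {1..n}) > \<delta>}
      \<le> exp (- C * real n))"
    show "q = p\<^sub>0"
      by (rule degree_limit_unique[where \<mu> = "\<lambda>n. two_star_pmf n \<beta>\<^sub>1 \<beta>\<^sub>2"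
            and f = "\<lambda>n x i. real (vertex_degree n x i) / (real n - 1)"])
        (use q degree_concentration[OF assms(1) mem p\<^sub>0(2)] in blast)
  qed
qed

end
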